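(* Let $A=\sigma(R)\langle x_1,\dots,x_n\rangle$ be a bijective skew PBW extension of a left Noetherian domain $R$, and let $d\geq 1$ be an integer. If $\mathrm{lKdim}(R)<d$ and $u_1,\dots,u_{d+n},u\in A$, then there exist $y_1,\dots,y_{d+n}\in A$ such that $$D(u_1,\dots,u_{d+n},u)=D(u_1+y_1u,\dots,u_{d+n}+y_{d+n}u).$$
   Context: Rings are associative with identity. Standing assumption: every ring $S$ considered satisfies the rank condition, i.e. for all integers $r,s\ge 1$, if there is an epimorphism of left $S$-modules $S^r\to S^s$ then $r\ge s$. $\mathrm{lKdim}$ denotes the left (Gabriel–Rentschler) Krull dimension of a ring. A domain is a (not necessarily commutative) nonzero ring without zero divisors. Skew PBW extension: Let $R\subseteq A$ be rings. $A$ is a skew PBW extension of $R$, written $A=\sigma(R)\langle x_1,\dots,x_n\rangle$, if there are finitely many elements $x_1,\dots,x_n\in A$ such that: (1) $A$ is a left free $R$-module with basis $\{x_1^{\alpha_1}\cdots x_n^{\alpha_n}\mid (\alpha_1,\dots,\alpha_n)\in\mathbb{N}^n\}$ (with $0\in\mathbb{N}$); (2) for every $1\le i\le n$ and $r\in R\setminus\{0\}$ there is $c_{i,r}\in R\setminus\{0\}$ with $x_ir-c_{i,r}x_i\in R$; (3) for all $1\le i,j\le n$ there is $c_{i,j}\in R\setminus\{0\}$ with $x_jx_i-c_{i,j}x_ix_j\in R+Rx_1+\cdots+Rx_n$. In this situation, for every $i$ there are an injective ring endomorphism $\sigma_i:R\to R$ and a $\sigma_i$-derivation $\delta_i:R\to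 R$ with $x_ir=\sigma_i(r)x_i+\delta_i(r)$ for all $r\in R$. $A$ is bijective if every $\sigma_i$ is bijective and $c_{i,j}$ is invertible for all $1\le i<j\le n$. For a ring $S$ and a subset $X\subseteq S$, $D(X)$ denotes the intersection of all (two-sided) prime ideals $P$ of $S$ with $X\subseteq P$; if there are no such primes, $D(X)=S$. For elements $s_1,\dots,s_m\in S$, $D(s_1,\dots,s_m):=D(\{s_1,\dots,s_m\})$. Here $D$ is taken in $S=A$. *)

theory Defs
  imports "HOL-Algebra.Algebra"
begin

section \<open>Noncommutative rings\<close>

text \<open>The library's \<^locale>\<open>domain\<close> and \<^locale>\<open>primeideal\<close> are commutative notions, so the
  noncommutative versions are defined here.\<close>

definition nc_domain :: "('a, 'b) ring_scheme \<Rightarrow> bool" where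
  "nc_domain S \<longleftrightarrow> ring S \<and> \<one>\<^bsub>S\<^esub> \<noteq> \<zero>\<^bsub>S\<^esub> \<and>
     (\<forall>a\<in>carrier S. \<forall>b\<in>carrier S. a \<otimes>\<^bsub>S\<^esub> b = \<zero>\<^bsub>S\<^esub> \<longrightarrow> a = \<zero>\<^bsub>S\<^esub> \<or> b = \<zero>\<^bsub>S\<^esub>)"

definition left_ideal :: "('a, 'b) ring_scheme \<Rightarrow> 'a set \<Rightarrow> bool" where
  "left_ideal S I \<longleftrightarrow> additive_subgroup I S \<and> (\<forall>a\<in>carrier S. \<forall>z\<in>I. a \<otimes>\<^bsub>S\<^esub> z \<in> I)"

definition left_noetherian :: "('a, 'b) ring_scheme \<Rightarrow> bool" where
  "left_noetherian S \<longleftrightarrow>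
     (\<forall>c :: nat \<Rightarrow> 'a set. (\<forall>i. left_ideal S (c i)) \<and> (\<forall>i. c i \<subseteq> c (Suc i)) \<longrightarrow>
        (\<exists>N. \<forall>i\<ge>N. c i = c N))"

definition nc_prime_ideal :: "('a, 'b) ring_scheme \<Rightarrow> 'a set \<Rightarrow> bool" where
  "nc_prime_ideal S P \<longleftrightarrow> ideal P S \<and> P \<noteq> carrier S \<and>
     (\<forall>I J. ideal I S \<and> ideal J S \<and> I \<cdot>\<^bsub>S\<^esub> J \<subseteq> P \<longrightarrow> I \<subseteq> P \<or> J \<subseteq> P)"

text \<open>Intersecting with the carrier only matters when no prime ideal contains \<open>Z\<close>;
  the value is then the whole ring.\<close>

definition prime_closure :: "('a, 'b) ring_scheme \<Rightarrow> 'a set \<Rightarrow> 'a set" where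
  "prime_closure S Z = carrier S \<inter> \<Inter> {P. nc_prime_ideal S P \<and> Z \<subseteq> P}"

text \<open>The free left module \<open>S\<^sup>r\<close> is represented by the extensional functions on
  \<open>{1..r}\<close> with componentwise operations.\<close>

definition left_module_epi ::
    "('a, 'b) ring_scheme \<Rightarrow> nat \<Rightarrow> nat \<Rightarrow> ((nat \<Rightarrow> 'a) \<Rightarrow> (nat \<Rightarrow> 'a)) \<Rightarrow> bool" where
  "left_module_epi S r s f \<longleftrightarrow>
     (\<forall>v\<in>{1..r} \<rightarrow>\<^sub>E carrier S. \<forall>w\<in>{1..r} \<rightarrow>\<^sub>E carrier S.
        f (\<lambda>i\<in>{1..r}. v i \<oplus>\<^bsub>S\<^esub> w i) = (\<lambda>j\<in>{1..s}. f v j \<oplus>\<^bsub>S\<^esub> f w j)) \<and>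
     (\<forall>a\<in>carrier S. \<forall>v\<in>{1..r} \<rightarrow>\<^sub>E carrier S.
        f (\<lambda>i\<in>{1..r}. a \<otimes>\<^bsub>S\<^esub> v i) = (\<lambda>j\<in>{1..s}. a \<otimes>\<^bsub>S\<^esub> f v j)) \<and>
     f ` ({1..r} \<rightarrow>\<^sub>E carrier S) = ({1..s} \<rightarrow>\<^sub>E carrier S)"

definition rank_condition :: "('a, 'b) ring_scheme \<Rightarrow> bool" where
  "rank_condition S \<longleftrightarrow>
     (\<forall>r s. 1 \<le> r \<and> 1 \<le> s \<and> (\<exists>f. left_module_epi S r s f) \<longrightarrow> r \<ge> s)"


section \<open>Gabriel--Rentschler Krull dimension\<close>

definition trivial_poset :: "'p::order set \<Rightarrow> bool" where
  "trivial_poset L \<longleftrightarrow> (\<forall>a\<in>L. \<forall>b\<in>L. a \<le> b \<longrightarrow> a = b)"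

definition interval_in :: "'p::order set \<Rightarrow> 'p \<Rightarrow> 'p \<Rightarrow> 'p set" where
  "interval_in L b a = {z\<in>L. b \<le> z \<and> z \<le> a}"

text \<open>\<open>has_deviation L \<alpha>\<close> says that the deviation of the poset \<open>L\<close> exists and equals the ordinal
  \<open>\<alpha>\<close>, where ordinals are the elements of a well-ordered type.  The deviation of a trivial poset
  is \<open>-\<infinity>\<close>, which is below every ordinal; hence trivial factors are always admitted in
  the chain condition and no ordinal is a deviation of a trivial poset.\<close>

function has_deviation :: "'p::order set \<Rightarrow> 'o::wellorder \<Rightarrow> bool" where
  "has_deviation L \<alpha> \<longleftrightarrow>
     \<not> trivial_poset L \<and>
     (\<forall>\<beta>\<in>{..<\<alpha>}. \<not> has_deviation L \<beta>) \<and>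
     (\<forall>c :: nat \<Rightarrow> 'p. (\<forall>i. c i \<in> L) \<and> (\<forall>i. c (Suc i) \<le> c i) \<longrightarrow>
        (\<exists>N. \<forall>i\<ge>N. trivial_poset (interval_in L (c (Suc i)) (c i)) \<or>
           (\<exists>\<beta>\<in>{..<\<alpha>}. has_deviation (interval_in L (c (Suc i)) (c i)) \<beta>)))"
  by pat_completeness auto
termination
  by (relation "inv_image {(\<beta>, \<alpha>). \<beta> < \<alpha>} snd") (auto intro: wf)

declare has_deviation.simps [simp del]

definition has_lKdim :: "('a, 'b) ring_scheme \<Rightarrow> 'o::wellorder \<Rightarrow> bool" where
  "has_lKdim S \<alpha> \<longleftrightarrow> has_deviation {I. left_ideal S I} \<alpha>"


section \<open>Skew PBW extensions\<close>

definition pbw_monomial ::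
    "('a, 'b) ring_scheme \<Rightarrow> nat \<Rightarrow> (nat \<Rightarrow> 'a) \<Rightarrow> (nat \<Rightarrow> nat) \<Rightarrow> 'a" where
  "pbw_monomial A n x \<alpha> = foldr (\<lambda>i m. (x i [^]\<^bsub>A\<^esub> \<alpha> i) \<otimes>\<^bsub>A\<^esub> m) [1..<Suc n] \<one>\<^bsub>A\<^esub>"

text \<open>The family of monomials, indexed by \<open>\<nat>\<^sup>n\<close>, is a basis of the left module \<open>A\<close> over \<open>R\<close>:
  every element has exactly one finitely supported coefficient function.\<close>

definition pbw_free_basis ::
    "('a, 'b) ring_scheme \<Rightarrow> 'a set \<Rightarrow> nat \<Rightarrow> (nat \<Rightarrow> 'a) \<Rightarrow> bool" where
  "pbw_free_basis A R n x \<longleftrightarrow>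
     (\<forall>a\<in>carrier A. \<exists>!f. f \<in> ({1..n} \<rightarrow>\<^sub>E UNIV) \<rightarrow>\<^sub>E R \<and>
        finite {\<alpha>\<in>{1..n} \<rightarrow>\<^sub>E UNIV. f \<alpha> \<noteq> \<zero>\<^bsub>A\<^esub>} \<and>
        a = (\<Oplus>\<^bsub>A\<^esub>\<alpha>\<in>{\<alpha>\<in>{1..n} \<rightarrow>\<^sub>E UNIV. f \<alpha> \<noteq> \<zero>\<^bsub>A\<^esub>}. f \<alpha> \<otimes>\<^bsub>A\<^esub> pbw_monomial A n x \<alpha>))"

text \<open>The set \<open>R + R x\<^sub>1 + \<dots> + R x\<^sub>n\<close>.\<close>

definition pbw_linear_part ::
    "('a, 'b) ring_scheme \<Rightarrow> 'a set \<Rightarrow> nat \<Rightarrow> (nat \<Rightarrow> 'a) \<Rightarrow> 'a set" where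
  "pbw_linear_part A R n x =
     {b \<oplus>\<^bsub>A\<^esub> (\<Oplus>\<^bsub>A\<^esub>k\<in>{1..n}. g k \<otimes>\<^bsub>A\<^esub> x k) | b g. b \<in> R \<and> g \<in> {1..n} \<rightarrow> R}"

definition skew_PBW_extension ::
    "('a, 'b) ring_scheme \<Rightarrow> 'a set \<Rightarrow> nat \<Rightarrow> (nat \<Rightarrow> 'a) \<Rightarrow> bool" where
  "skew_PBW_extension A R n x \<longleftrightarrow>
     ring A \<and> subring R A \<and> x \<in> {1..n} \<rightarrow> carrier A \<and>
     pbw_free_basis A R n x \<and>
     (\<forall>i\<in>{1..n}. \<forall>r\<in>R - {\<zero>\<^bsub>A\<^esub>}. \<exists>c\<in>R - {\<zero>\<^bsub>A\<^esub>}.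
        (x i \<otimes>\<^bsub>A\<^esub> r) \<ominus>\<^bsub>A\<^esub> (c \<otimes>\<^bsub>A\<^esub> x i) \<in> R) \<and>
     (\<forall>i\<in>{1..n}. \<forall>j\<in>{1..n}. \<exists>c\<in>R - {\<zero>\<^bsub>A\<^esub>}.
        (x j \<otimes>\<^bsub>A\<^esub> x i) \<ominus>\<^bsub>A\<^esub> (c \<otimes>\<^bsub>A\<^esub> x i \<otimes>\<^bsub>A\<^esub> x j) \<in> pbw_linear_part A R n x)"

definition skew_derivation ::
    "('a, 'b) ring_scheme \<Rightarrow> ('a \<Rightarrow> 'a) \<Rightarrow> ('a \<Rightarrow> 'a) \<Rightarrow> bool" where
  "skew_derivation S \<sigma> \<delta> \<longleftrightarrow>
     \<delta> \<in> carrier S \<rightarrow> carrier S \<and>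
     (\<forall>r\<in>carrier S. \<forall>s\<in>carrier S. \<delta> (r \<oplus>\<^bsub>S\<^esub> s) = \<delta> r \<oplus>\<^bsub>S\<^esub> \<delta> s) \<and>
     (\<forall>r\<in>carrier S. \<forall>s\<in>carrier S.
        \<delta> (r \<otimes>\<^bsub>S\<^esub> s) = (\<sigma> r \<otimes>\<^bsub>S\<^esub> \<delta> s) \<oplus>\<^bsub>S\<^esub> (\<delta> r \<otimes>\<^bsub>S\<^esub> s))"

text \<open>In a skew PBW extension the maps \<open>\<sigma>\<^sub>i\<close> and \<open>\<delta>\<^sub>i\<close> (on \<open>R\<close>) with
  \<open>x\<^sub>i r = \<sigma>\<^sub>i(r) x\<^sub>i + \<delta>\<^sub>i(r)\<close>, and the coefficients \<open>c\<^sub>i\<^sub>j\<close> for \<open>i < j\<close>, are uniquely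
  determined by freeness, so they are bound by existential quantifiers here.  Invertibility of
  \<open>c\<^sub>i\<^sub>j\<close> means invertibility in \<open>R\<close>.\<close>

definition bijective_skew_PBW_extension ::
    "('a, 'b) ring_scheme \<Rightarrow> 'a set \<Rightarrow> nat \<Rightarrow> (nat \<Rightarrow> 'a) \<Rightarrow> bool" where
  "bijective_skew_PBW_extension A R n x \<longleftrightarrow>
     skew_PBW_extension A R n x \<and>
     (\<forall>i\<in>{1..n}. \<exists>\<sigma> \<delta>.
        \<sigma> \<in> ring_hom (A\<lparr>carrier := R\<rparr>) (A\<lparr>carrier := R\<rparr>) \<and>
        skew_derivation (A\<lparr>carrier := R\<rparr>) \<sigma> \<delta> \<and>
        (\<forall>r\<in>R. x i \<otimes>\<^bsub>A\<^esub> r = (\<sigma> r \<otimes>\<^bsub>A\<^esub> x i) \<oplus>\<^bsub>A\<^esub> \<delta> r) \<and>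
        bij_betw \<sigma> R R) \<and>
     (\<forall>i\<in>{1..n}. \<forall>j\<in>{1..n}. i < j \<longrightarrow>
        (\<exists>c\<in>Units (A\<lparr>carrier := R\<rparr>).
           (x j \<otimes>\<^bsub>A\<^esub> x i) \<ominus>\<^bsub>A\<^esub> (c \<otimes>\<^bsub>A\<^esub> x i \<otimes>\<^bsub>A\<^esub> x j) \<in> pbw_linear_part A R n x))"

end

theory Submission
  imports Defs
begin

text \<open>Every left ideal \<open>I\<close> of \<open>A\<close> is sent to the family of left ideals of \<open>R\<close> formed by the leading
  coefficients of elements of \<open>I\<close> with a given leading exponent in the degree lexicographic order.
  This is a strictly increasing map into the monotone maps from \<open>\<nat>\<^sup>n\<close> to the left ideals of \<open>R\<close>,
  a poset that is again Noetherian and has deviation at most \<open>n\<close> more than that of the left ideals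
  of \<open>R\<close>. So \<open>A\<close> is left Noetherian with left Krull dimension less than \<open>d + n\<close>.

  If \<open>P \<subset> Q\<close> are primes of a left Noetherian ring \<open>S\<close>, some \<open>c \<in> Q\<close> is not a right zero divisor
  modulo \<open>P\<close>, and the chain of the left ideals \<open>S c\<^sup>i + P\<close> has all factors at least as large as
  \<open>S/Q\<close>; hence chains of primes are bounded by the Krull dimension. Finally, using that there are
  finitely many minimal primes over an ideal, prime avoidance yields successively
  \<open>w\<^sub>i = u\<^sub>i + y\<^sub>i u\<close> such that every prime containing \<open>w\<^sub>1, \<dots>, w\<^sub>i\<close> but not \<open>u\<close> has height
  at least \<open>i\<close>; for \<open>i = d + n\<close> there is no such prime.\<close>

section \<open>Deviation of posets of monotone maps\<close>

text \<open>The relation between two variables of \<open>A\<close> may involve all the others, so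
  there need not be intermediate rings through which the variables could be adjoined one at a time.
  The induction on \<open>n\<close> therefore takes place on posets, by adding one coordinate to the
  monotone maps. Taking leading coefficients does not respect sums of left ideals and is not
  injective; it is only strict on comparable pairs. Hence chain conditions and deviation are handled
  as bounds that can be pulled back along any strictly increasing map.

  Bijectivity enters twice: surjectivity of the twists allows coefficients to be written on the
  right of a word, and invertibility of the commutation coefficients makes the order of the letters
  irrelevant up to units and shorter words.

  The number \<open>d + n\<close> arises as follows: Krull dimension below \<open>d\<close> is
  \<open>dev_less d\<close>, each variable adds one, and \<open>dev_less m\<close> allows chains of
  at most \<open>m\<close> primes, whereas a prime containing all \<open>m\<close> modified elements
  but not \<open>u\<close> would be the top of a chain of \<open>m + 1\<close>.\<close>

definition acc :: "'p::order set \<Rightarrow> bool" where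
  "acc L \<longleftrightarrow> (\<forall>c :: nat \<Rightarrow> 'p. (\<forall>i. c i \<in> L) \<and> (\<forall>i. c i \<le> c (Suc i)) \<longrightarrow> (\<exists>N. \<forall>i\<ge>N. c i = c N))"

text \<open>A form of the definition whose premises can be discharged separately by
  \<open>rule\<close>.\<close>

lemma acc_stable:
  assumes "acc L" "\<And>i. c i \<in> L" "\<And>i. c i \<le> c (Suc i)"
  shows "\<exists>N. \<forall>i\<ge>N. c i = c N"
  using assms(1)[unfolded acc_def, rule_format, of c] assms(2,3) by blast

lemma acc_wf:
  assumes "acc L"
  shows "wf {(b, a). a \<in> L \<and> b \<in> L \<and> a < b}"
  unfolding wf_iff_no_infinite_down_chain
proof
  assume "\<exists>f. \<forall>i. (f (Suc i), f i) \<in> {(b, a). a \<in> L \<and> b \<in> L \<and> a < b}"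
  then obtain f where f: "\<And>i. f i \<in> L" "\<And>i. f i < f (Suc i)" by auto
  have "\<exists>N. \<forall>i\<ge>N. f i = f N"
    by (rule acc_stable[OF assms]) (use f less_imp_le in auto)
  then obtain N where "\<forall>i\<ge>N. f i = f N" by blast
  from this[rule_format, of "Suc N"] have "f (Suc N) = f N" by simp
  then show False using f(2)[of N] by simp
qed

lemma acc_maximal:
  assumes "acc L" "S \<subseteq> L" "S \<noteq> {}"
  shows "\<exists>a\<in>S. \<forall>b\<in>S. \<not> a < b"
proof -
  obtain s where "s \<in> S" using assms(3) by auto
  from wfE_min[OF acc_wf[OF assms(1)] this] obtain z
    where z: "z \<in> S" "\<And>y. (y, z) \<in> {(b, a). a \<in> L \<and> b \<in> L \<and> a < b} \<Longrightarrow> y \<notin> S" by blast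
  have "\<not> z < b" if "b \<in> S" for b using z(2)[of b] z(1) that assms(2) by auto
  with z(1) show ?thesis by blast
qed

text \<open>Members of a chain are comparable, so equal images force equal members; injectivity of
  \<open>f\<close> on incomparable elements is irrelevant.\<close>

lemma acc_strict_mono:
  assumes "acc Q" "\<And>a. a \<in> P \<Longrightarrow> f a \<in> Q"
    and "\<And>a b. a \<in> P \<Longrightarrow> b \<in> P \<Longrightarrow> a < b \<Longrightarrow> f a < f b"
  shows "acc P"
  unfolding acc_def
proof (intro allI impI, elim conjE)
  fix c :: "nat \<Rightarrow> _" assume c: "\<forall>i. c i \<in> P" "\<forall>i. c i \<le> c (Suc i)"
  have "f (c i) \<le> f (c (Suc i))" for i
    using c assms(3) by (metis order_le_less)
  moreover have "f (c i) \<in> Q" for i using c assms(2) by blast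
  ultimately have "\<exists>N. \<forall>i\<ge>N. f (c i) = f (c N)"
    by (intro acc_stable[OF assms(1), of "\<lambda>i. f (c i)"])
  then obtain N where N: "\<And>i. i \<ge> N \<Longrightarrow> f (c i) = f (c N)" by blast
  have "c i = c N" if "i \<ge> N" for i
  proof -
    have "c N \<le> c i" using c(2) that by (simp add: lift_Suc_mono_le)
    then show ?thesis using N[OF that] assms(3) c(1) by (metis order_le_less less_irrefl)
  qed
  then show "\<exists>N. \<forall>i\<ge>N. c i = c N" by blast
qed

text \<open>\<open>dev_less k L\<close> says that the deviation of \<open>L\<close> is less than \<open>k\<close>; for \<open>k = 0\<close> it has to be
  \<open>-\<infinity>\<close>.\<close>

primrec dev_less :: "nat \<Rightarrow> 'p::order set \<Rightarrow> bool" where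
  "dev_less 0 L \<longleftrightarrow> trivial_poset L"
| "dev_less (Suc k) L \<longleftrightarrow> (\<forall>c. (\<forall>i. c i \<in> L) \<and> (\<forall>i. c (Suc i) \<le> c i) \<longrightarrow>
     (\<forall>\<^sub>F i in sequentially. dev_less k (interval_in L (c (Suc i)) (c i))))"

text \<open>A chain in \<open>P\<close> is carried to a chain in \<open>Q\<close>, and each interval
  is mapped strictly into the interval between the images of its ends, so the bound descends level
  by level.\<close>

lemma dev_less_strict_mono:
  fixes f :: "'p::order \<Rightarrow> 'q::order"
  assumes "dev_less k Q" "\<And>a. a \<in> P \<Longrightarrow> f a \<in> Q"
    and "\<And>a b. a \<in> P \<Longrightarrow> b \<in> P \<Longrightarrow> a < b \<Longrightarrow> f a < f b"
  shows "dev_less k P"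
  using assms
proof (induction k arbitrary: P Q)
  case 0
  then show ?case unfolding dev_less.simps trivial_poset_def
    by (metis order_le_less less_irrefl)
next
  case (Suc k)
  have mono: "f a \<le> f b" if "a \<in> P" "b \<in> P" "a \<le> b" for a b
    using that Suc.prems(3) by (metis order_le_less)
  show ?case unfolding dev_less.simps
  proof (intro allI impI, elim conjE)
    fix c :: "nat \<Rightarrow> 'p" assume c: "\<forall>i. c i \<in> P" "\<forall>i. c (Suc i) \<le> c i"
    have "\<forall>\<^sub>F i in sequentially. dev_less k (interval_in Q (f (c (Suc i))) (f (c i)))"
      using Suc.prems(1)[unfolded dev_less.simps, rule_format, of "\<lambda>i. f (c i)"]
        Suc.prems(2) mono c by blast
    then show "\<forall>\<^sub>F i in sequentially. dev_less k (interval_in P (c (Suc i)) (c i))"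
    proof (rule eventually_mono)
      fix i assume "dev_less k (interval_in Q (f (c (Suc i))) (f (c i)))"
      then show "dev_less k (interval_in P (c (Suc i)) (c i))"
        by (rule Suc.IH) (use Suc.prems mono c in \<open>auto simp: interval_in_def\<close>)
    qed
  qed
qed

lemma dev_less_subset: "dev_less k Q \<Longrightarrow> P \<subseteq> Q \<Longrightarrow> dev_less k P"
  using dev_less_strict_mono[of k Q P id] by auto

lemma dev_less_Suc: "dev_less k L \<Longrightarrow> dev_less (Suc k) L"
proof (induction k arbitrary: L)
  case 0
  have "dev_less 0 (interval_in L a b)" for a b
    by (rule dev_less_subset[OF 0]) (auto simp: interval_in_def)
  then show ?case by simp
next
  case (Suc k)
  show ?case
    unfolding dev_less.simps(2)[of "Suc k"]
  proof (intro allI impI)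
    fix c :: "nat \<Rightarrow> _" assume c: "(\<forall>i. c i \<in> L) \<and> (\<forall>i. c (Suc i) \<le> c i)"
    from Suc.prems c have "\<forall>\<^sub>F i in sequentially. dev_less k (interval_in L (c (Suc i)) (c i))" by simp
    then show "\<forall>\<^sub>F i in sequentially. dev_less (Suc k) (interval_in L (c (Suc i)) (c i))"
      by (rule eventually_mono) (rule Suc.IH)
  qed
qed

lemma dev_less_mono: "k \<le> l \<Longrightarrow> dev_less k L \<Longrightarrow> dev_less l L"
  by (induction rule: dec_induct) (blast intro: dev_less_Suc)+

text \<open>A trivial factor satisfies \<open>dev_less 0\<close> and a factor of deviation
  \<open>\<beta> < k\<close> satisfies \<open>dev_less (Suc \<beta>)\<close> by induction; both
  imply \<open>dev_less k\<close>.\<close>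

lemma has_deviation_dev_less:
  fixes k :: nat
  assumes "has_deviation L k"
  shows "dev_less (Suc k) L"
  using assms
proof (induction k arbitrary: L rule: less_induct)
  case (less k)
  show ?case unfolding dev_less.simps
  proof (intro allI impI)
    fix c assume c: "(\<forall>i. c i \<in> L) \<and> (\<forall>i. c (Suc i) \<le> c i)"
    then obtain N where N: "\<forall>i\<ge>N. trivial_poset (interval_in L (c (Suc i)) (c i)) \<or>
           (\<exists>\<beta>\<in>{..<k}. has_deviation (interval_in L (c (Suc i)) (c i)) \<beta>)"
      using less.prems has_deviation.simps[of L k] by blast
    have "dev_less k (interval_in L (c (Suc i)) (c i))" if "i \<ge> N" for i
      using N[rule_format, OF that]
    proof
      assume "trivial_poset (interval_in L (c (Suc i)) (c i))"
      then show ?thesis using dev_less_mono[of 0] by simp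
    next
      assume "\<exists>\<beta>\<in>{..<k}. has_deviation (interval_in L (c (Suc i)) (c i)) \<beta>"
      then obtain \<beta> where "\<beta> < k" "has_deviation (interval_in L (c (Suc i)) (c i)) \<beta>" by auto
      then show ?thesis using less.IH dev_less_mono by (metis Suc_leI)
    qed
    then show "\<forall>\<^sub>F i in sequentially. dev_less k (interval_in L (c (Suc i)) (c i))"
      by (auto simp: eventually_sequentially)
  qed
qed

text \<open>The bound for a finite product of posets, in the shape needed for a sequence cut into
  finitely many entries \<open>h j\<close> and a tail \<open>g\<close>. As \<open>M\<close> is
  finite, the eventual bounds for the coordinates hold simultaneously from some index on.\<close>

lemma dev_less_jointly_strict:
  fixes h :: "nat \<Rightarrow> 'p::order \<Rightarrow> 'q::order" and g :: "'p \<Rightarrow> 'r::order"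
  assumes "\<And>j. j < M \<Longrightarrow> dev_less k (q j)" "dev_less k Q'"
    and "\<And>a j. a \<in> P \<Longrightarrow> j < M \<Longrightarrow> h j a \<in> q j" "\<And>a. a \<in> P \<Longrightarrow> g a \<in> Q'"
    and "\<And>a b j. a \<in> P \<Longrightarrow> b \<in> P \<Longrightarrow> a \<le> b \<Longrightarrow> j < M \<Longrightarrow> h j a \<le> h j b"
    and "\<And>a b. a \<in> P \<Longrightarrow> b \<in> P \<Longrightarrow> a \<le> b \<Longrightarrow> g a \<le> g b"
    and "\<And>a b. a \<in> P \<Longrightarrow> b \<in> P \<Longrightarrow> a \<le> b \<Longrightarrow> (\<And>j. j < M \<Longrightarrow> h j a = h j b) \<Longrightarrow> g a = g b \<Longrightarrow> a = b"
  shows "dev_less k P"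
  using assms
proof (induction k arbitrary: P q Q')
  case 0
  have "a = b" if "a \<in> P" "b \<in> P" "a \<le> b" for a b
  proof (rule "0.prems"(7)[OF that])
    show "h j a = h j b" if "j < M" for j
      using "0.prems"(1,3,5) \<open>a \<in> P\<close> \<open>b \<in> P\<close> \<open>a \<le> b\<close> that
      unfolding dev_less.simps trivial_poset_def by meson
    show "g a = g b"
      using "0.prems"(2,4,6) \<open>a \<in> P\<close> \<open>b \<in> P\<close> \<open>a \<le> b\<close>
      unfolding dev_less.simps trivial_poset_def by meson
  qed
  then show ?case by (simp add: trivial_poset_def)
next
  case (Suc k)
  show ?case unfolding dev_less.simps
  proof (intro allI impI, elim conjE)
    fix c :: "nat \<Rightarrow> 'p" assume c: "\<forall>i. c i \<in> P" "\<forall>i. c (Suc i) \<le> c i"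
    have 1: "\<forall>\<^sub>F i in sequentially. \<forall>j\<in>{..<M}.
        dev_less k (interval_in (q j) (h j (c (Suc i))) (h j (c i)))"
    proof (rule eventually_ball_finite, simp, intro ballI)
      fix j assume "j \<in> {..<M}"
      then have j: "j < M" by simp
      show "\<forall>\<^sub>F i in sequentially. dev_less k (interval_in (q j) (h j (c (Suc i))) (h j (c i)))"
        using Suc.prems(1)[OF j, unfolded dev_less.simps, rule_format, of "\<lambda>i. h j (c i)"]
          Suc.prems(3,5) j c by blast
    qed
    have 2: "\<forall>\<^sub>F i in sequentially. dev_less k (interval_in Q' (g (c (Suc i))) (g (c i)))"
      using Suc.prems(2)[unfolded dev_less.simps, rule_format, of "\<lambda>i. g (c i)"]
          Suc.prems(4,6) c by blast
    show "\<forall>\<^sub>F i in sequentially. dev_less k (interval_in P (c (Suc i)) (c i))"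
      using 1 2
    proof eventually_elim
      case (elim i)
      let ?J = "interval_in P (c (Suc i)) (c i)"
      have J: "a \<in> P \<and> c (Suc i) \<le> a \<and> a \<le> c i" if "a \<in> ?J" for a
        using that by (simp add: interval_in_def)
      show ?case
      proof (rule Suc.IH[where q = "\<lambda>j. interval_in (q j) (h j (c (Suc i))) (h j (c i))"
             and Q' = "interval_in Q' (g (c (Suc i))) (g (c i))" and P = ?J])
        show "h j a \<in> interval_in (q j) (h j (c (Suc i))) (h j (c i))" if "a \<in> ?J" "j < M" for a j
          using J[OF that(1)] that(2) Suc.prems(3,5) c(1) by (simp add: interval_in_def)
        show "g a \<in> interval_in Q' (g (c (Suc i))) (g (c i))" if "a \<in> ?J" for a
          using J[OF that] Suc.prems(4,6) c(1) by (simp add: interval_in_def)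
      qed (use elim J Suc.prems(5,6,7) in \<open>simp_all\<close>)
    qed
  qed
qed

section \<open>Monotone sequences and monotone maps on exponent lists\<close>

definition mono_seq :: "'p::order set \<Rightarrow> (nat \<Rightarrow> 'p) set" where
  "mono_seq L = {f. (\<forall>i. f i \<in> L) \<and> mono f}"

lemma trivial_mono_seq: "trivial_poset L \<Longrightarrow> trivial_poset (mono_seq L)"
  unfolding trivial_poset_def mono_seq_def by (auto simp: le_fun_def fun_eq_iff)

lemma mono_seq_stable:
  assumes "acc L" "f \<in> mono_seq L"
  shows "\<exists>N. \<forall>i\<ge>N. f i = f N"
proof (rule acc_stable[OF assms(1)])
  show "f i \<in> L" "f i \<le> f (Suc i)" for i
    using assms(2) by (auto simp: mono_seq_def mono_def)
qed

text \<open>The diagonal of an ascending chain of monotone sequences becomes constant from some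
  \<open>N\<close> on. This controls all columns from \<open>N\<close> on at once; the finitely many
  columns before \<open>N\<close> stabilise one by one.\<close>

lemma acc_mono_seq:
  assumes "acc L"
  shows "acc (mono_seq L)"
  unfolding acc_def
proof (intro allI impI, elim conjE)
  fix c :: "nat \<Rightarrow> nat \<Rightarrow> 'a"
  assume c: "\<forall>i. c i \<in> mono_seq L" "\<forall>i. c i \<le> c (Suc i)"
  have le: "c i j \<le> c i' j'" if "i \<le> i'" "j \<le> j'" for i i' j j'
  proof -
    have "c i \<le> c i'" using c(2) that(1) by (simp add: lift_Suc_mono_le)
    moreover have "c i' j \<le> c i' j'" using c(1) that(2) by (auto simp: mono_seq_def mono_def)
    ultimately show ?thesis by (meson le_funD order_trans)
  qed
  have L: "c i j \<in> L" for i j using c(1) by (auto simp: mono_seq_def)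
  have "\<exists>N. \<forall>i\<ge>N. c i i = c N N"
    by (rule acc_stable[OF assms, of "\<lambda>i. c i i"]) (simp_all add: L le)
  then obtain N where N: "\<And>i. i \<ge> N \<Longrightarrow> c i i = c N N" by blast
  have "\<forall>j. \<exists>N. \<forall>i\<ge>N. c i j = c N j"
  proof
    fix j show "\<exists>N. \<forall>i\<ge>N. c i j = c N j"
      by (rule acc_stable[OF assms, of "\<lambda>i. c i j"]) (simp_all add: L le)
  qed
  from choice[OF this] obtain N' where N': "\<And>i j. i \<ge> N' j \<Longrightarrow> c i j = c (N' j) j" by blast
  define M where "M = N + (\<Sum>j<N. N' j)"
  have "c i j = c M j" if "i \<ge> M" for i j
  proof (cases "j < N")
    case True
    then have "N' j \<le> (\<Sum>j<N. N' j)" by (intro member_le_sum) auto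
    then have "N' j \<le> M" unfolding M_def by simp
    then show ?thesis using N'[of j i] N'[of j M] that by simp
  next
    case False
    \<comment> \<open>The entry is squeezed between two entries of the constant part of the
      diagonal.\<close>
    have "c i' j = c N N" if "i' \<ge> N" for i'
    proof (rule order_antisym)
      show "c N N \<le> c i' j" using le that False by simp
      have "c i' j \<le> c (max i' j) (max i' j)" by (rule le) auto
      also have "\<dots> = c N N" by (rule N) (use that in auto)
      finally show "c i' j \<le> c N N" .
    qed
    then show ?thesis using that unfolding M_def by simp
  qed
  then have "\<forall>i\<ge>M. c i = c M" by blast
  then show "\<exists>N. \<forall>i\<ge>N. c i = c N" by blast
qed

text \<open>By \<open>acc\<close> each sequence has a final value, and the final values of a
  descending chain descend in \<open>L\<close>. In a late factor the tails therefore lie in an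
  interval of smaller deviation, to which the induction hypothesis applies, and only finitely many
  entries in \<open>L\<close> remain.\<close>

lemma dev_less_mono_seq:
  assumes "acc L" "dev_less k L"
  shows "dev_less (Suc k) (mono_seq L)"
  using assms
proof (induction k arbitrary: L)
  case 0
  have "dev_less 0 (mono_seq L)" using trivial_mono_seq 0 by simp
  then show ?case by (rule dev_less_Suc)
next
  case (Suc k)
  show ?case unfolding dev_less.simps(2)[of "Suc k"]
  proof (intro allI impI, elim conjE)
    fix c :: "nat \<Rightarrow> nat \<Rightarrow> 'a"
    assume c: "\<forall>i. c i \<in> mono_seq L" "\<forall>i. c (Suc i) \<le> c i"
    have "\<forall>i. \<exists>N. \<forall>j\<ge>N. c i j = c i N"
      using mono_seq_stable[OF Suc.prems(1)] c(1) by blast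
    from choice[OF this] obtain N where N: "\<And>i j. j \<ge> N i \<Longrightarrow> c i j = c i (N i)" by blast
    define s where "s i = c i (N i)" for i
    have s: "c i j = s i" if "j \<ge> N i" for i j using N[OF that] by (simp add: s_def)
    have "s i \<in> L" for i using c(1) by (auto simp: s_def mono_seq_def)
    moreover have "s (Suc i) \<le> s i" for i
      using s[of i "max (N i) (N (Suc i))"] s[of "Suc i" "max (N i) (N (Suc i))"]
        le_funD[OF c(2)[rule_format, of i], of "max (N i) (N (Suc i))"] by simp
    ultimately have ev: "\<forall>\<^sub>F i in sequentially. dev_less k (interval_in L (s (Suc i)) (s i))"
      using Suc.prems(2)[unfolded dev_less.simps, rule_format, of s] by blast
    show "\<forall>\<^sub>F i in sequentially. dev_less (Suc k) (interval_in (mono_seq L) (c (Suc i)) (c i))"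
      using ev
    proof (rule eventually_mono)
      fix i assume d: "dev_less k (interval_in L (s (Suc i)) (s i))"
      \<comment> \<open>From \<open>M\<close> on both end points of the factor are constant.\<close>
      define M where "M = max (N i) (N (Suc i))"
      have sM: "c i (M + j) = s i" "c (Suc i) (M + j) = s (Suc i)" for j
        using s[of i "M + j"] s[of "Suc i" "M + j"] by (auto simp: M_def)
      have a: "acc (interval_in L (s (Suc i)) (s i))"
        by (rule acc_strict_mono[OF Suc.prems(1), of _ id]) (auto simp: interval_in_def)
      show "dev_less (Suc k) (interval_in (mono_seq L) (c (Suc i)) (c i))"
      proof (rule dev_less_jointly_strict[OF _ Suc.IH[OF a d], where q = "\<lambda>_. L" and h = "\<lambda>j f. f j"
            and g = "\<lambda>f j. f (M + j)" and M = M])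
        fix f assume "f \<in> interval_in (mono_seq L) (c (Suc i)) (c i)"
        then have f: "\<And>j. f j \<in> L" "mono f" "\<And>j. c (Suc i) j \<le> f j" "\<And>j. f j \<le> c i j"
          by (auto simp: interval_in_def mono_seq_def le_fun_def)
        have "f (M + j) \<in> interval_in L (s (Suc i)) (s i)" for j
          using f(1)[of "M + j"] f(3,4)[of "M + j"] sM[of j] by (simp add: interval_in_def)
        moreover have "mono (\<lambda>j. f (M + j))" using f(2) by (simp add: mono_def)
        ultimately show "(\<lambda>j. f (M + j)) \<in> mono_seq (interval_in L (s (Suc i)) (s i))"
          by (simp add: mono_seq_def)
      next
        fix f g :: "nat \<Rightarrow> 'a"
        assume 1: "\<And>j. j < M \<Longrightarrow> f j = g j" and 2: "(\<lambda>j. f (M + j)) = (\<lambda>j. g (M + j))"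
        show "f = g"
        proof
          fix j show "f j = g j"
            using 1[of j] fun_cong[OF 2, of "j - M"] by (cases "j < M") auto
        qed
      next
        show "dev_less (Suc k) L" by (rule Suc.prems(2))
      next
        fix f j assume "f \<in> interval_in (mono_seq L) (c (Suc i)) (c i)"
        then show "f j \<in> L" by (simp add: interval_in_def mono_seq_def)
      qed (simp_all add: le_fun_def)
    qed
  qed
qed

text \<open>Outside lists of length \<open>n\<close> the value is fixed, so that the order is that of the
  monotone maps \<open>\<nat>\<^sup>n \<rightarrow> L\<close>.\<close>

definition mono_list :: "nat \<Rightarrow> 'p::order set \<Rightarrow> (nat list \<Rightarrow> 'p) set" where
  "mono_list n L = {f. (\<forall>l. length l = n \<longrightarrow> f l \<in> L) \<and>
     (\<forall>l l'. length l = n \<longrightarrow> list_all2 (\<le>) l l' \<longrightarrow> f l \<le> f l') \<and>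
     (\<forall>l. length l \<noteq> n \<longrightarrow> f l = undefined)}"

text \<open>Currying: a monotone map on exponent lists of length \<open>Suc n\<close> is a monotone
  sequence of monotone maps on lists of length \<open>n\<close>, so every coordinate costs
  one.\<close>

lemma mono_list_bounds:
  assumes "acc L" "dev_less k L"
  shows "acc (mono_list n L) \<and> dev_less (k + n) (mono_list n L)"
proof (induction n)
  case 0
  have strict: "f [] < g []" if "f \<in> mono_list 0 L" "g \<in> mono_list 0 L" "f < g" for f g
  proof -
    have "f l = undefined" "g l = undefined" if "l \<noteq> []" for l
      using that \<open>f \<in> mono_list 0 L\<close> \<open>g \<in> mono_list 0 L\<close> by (auto simp: mono_list_def)
    then have "f [] \<noteq> g []" using \<open>f < g\<close> by (metis ext less_irrefl)
    then show ?thesis using \<open>f < g\<close> by (simp add: le_fun_def less_le)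
  qed
  have mem: "f [] \<in> L" if "f \<in> mono_list 0 L" for f using that by (simp add: mono_list_def)
  show ?case
    using acc_strict_mono[OF assms(1), of "mono_list 0 L" "\<lambda>f. f []"]
      dev_less_strict_mono[OF assms(2), of "mono_list 0 L" "\<lambda>f. f []"] strict mem by simp
next
  case (Suc n)
  define F :: "(nat list \<Rightarrow> 'a) \<Rightarrow> nat \<Rightarrow> nat list \<Rightarrow> 'a"
    where "F f a l = (if length l = n then f (a # l) else undefined)" for f a l
  have mem: "F f \<in> mono_seq (mono_list n L)" if "f \<in> mono_list (Suc n) L" for f
  proof -
    have le: "f l \<le> f l'" if "length l = Suc n" "list_all2 (\<le>) l l'" for l l'
      using that \<open>f \<in> mono_list (Suc n) L\<close> by (auto simp: mono_list_def)
    have "mono (F f)" unfolding mono_def le_fun_def F_def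
      using le by (auto intro!: le simp: list_all2_refl)
    moreover have "F f a \<in> mono_list n L" for a
      using \<open>f \<in> mono_list (Suc n) L\<close> le
      by (auto simp: mono_list_def F_def dest: list_all2_lengthD)
    ultimately show ?thesis by (simp add: mono_seq_def)
  qed
  have strict: "F f < F g" if "f \<in> mono_list (Suc n) L" "g \<in> mono_list (Suc n) L" "f < g" for f g
  proof -
    have "F f \<le> F g" using le_funD[OF less_imp_le[OF \<open>f < g\<close>]] by (simp add: le_fun_def F_def)
    moreover have "F f \<noteq> F g"
    proof
      assume eq: "F f = F g"
      have "f l = g l" for l
      proof (cases "length l = Suc n")
        case True
        then obtain a l' where "l = a # l'" "length l' = n" by (auto simp: length_Suc_conv)
        then show ?thesis using fun_cong[OF fun_cong[OF eq, of a], of l'] by (simp add: F_def)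
      next
        case False
        then show ?thesis using that by (auto simp: mono_list_def)
      qed
      then show False using \<open>f < g\<close> by (metis ext less_irrefl)
    qed
    ultimately show ?thesis by simp
  qed
  have "acc (mono_list (Suc n) L)"
    by (rule acc_strict_mono[OF acc_mono_seq mem strict]) (use Suc in auto)
  moreover have "dev_less (Suc (k + n)) (mono_list (Suc n) L)"
    by (rule dev_less_strict_mono[OF dev_less_mono_seq mem strict]) (use Suc in auto)
  ultimately show ?case by (simp del: dev_less.simps)
qed


section \<open>Regular elements modulo a prime and chains of primes\<close>

context ring
begin

lemma left_ideal_closed:
  assumes "left_ideal R I"
  shows "I \<subseteq> carrier R" "\<zero> \<in> I" "\<And>a b. a \<in> I \<Longrightarrow> b \<in> I \<Longrightarrow> a \<oplus> b \<in> I"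
    "\<And>a. a \<in> I \<Longrightarrow> \<ominus> a \<in> I" "\<And>a b. a \<in> I \<Longrightarrow> b \<in> I \<Longrightarrow> a \<ominus> b \<in> I"
    "\<And>a r. a \<in> I \<Longrightarrow> r \<in> carrier R \<Longrightarrow> r \<otimes> a \<in> I"
proof -
  have I: "additive_subgroup I R" using assms by (simp add: left_ideal_def)
  show "I \<subseteq> carrier R" using additive_subgroup.a_subset[OF I] .
  show "\<zero> \<in> I" using additive_subgroup.zero_closed[OF I] .
  show add: "\<And>a b. a \<in> I \<Longrightarrow> b \<in> I \<Longrightarrow> a \<oplus> b \<in> I" using additive_subgroup.a_closed[OF I] .
  show inv: "\<And>a. a \<in> I \<Longrightarrow> \<ominus> a \<in> I" using additive_subgroup.a_inv_closed[OF I] abelian_group_axioms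
    by blast
  show "\<And>a b. a \<in> I \<Longrightarrow> b \<in> I \<Longrightarrow> a \<ominus> b \<in> I" unfolding a_minus_def using add inv by blast
  show "\<And>a r. a \<in> I \<Longrightarrow> r \<in> carrier R \<Longrightarrow> r \<otimes> a \<in> I" using assms by (simp add: left_ideal_def)
qed

lemma left_idealI:
  assumes "I \<subseteq> carrier R" "\<zero> \<in> I" "\<And>a b. a \<in> I \<Longrightarrow> b \<in> I \<Longrightarrow> a \<oplus> b \<in> I"
    "\<And>a r. a \<in> I \<Longrightarrow> r \<in> carrier R \<Longrightarrow> r \<otimes> a \<in> I"
  shows "left_ideal R I"
  unfolding left_ideal_def
proof
  have "\<ominus> a \<in> I" if "a \<in> I" for a
  proof -
    have "\<ominus> a = (\<ominus> \<one>) \<otimes> a" using assms(1) that by (simp add: l_minus subset_iff)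
    then show ?thesis using assms(4)[OF that, of "\<ominus> \<one>"] by simp
  qed
  then have "subgroup I (add_monoid R)"
    using assms by (intro add.subgroupI) (auto simp: a_inv_def)
  then show "additive_subgroup I R" by (rule additive_subgroup.intro)
  show "\<forall>a\<in>carrier R. \<forall>z\<in>I. a \<otimes> z \<in> I" using assms(4) by blast
qed

lemma ideal_left_ideal: "ideal I R \<Longrightarrow> left_ideal R I"
  unfolding left_ideal_def
  by (simp add: ideal.I_l_closed ideal.axioms(1))

lemma idealI_left:
  assumes "left_ideal R I" "\<And>a r. a \<in> I \<Longrightarrow> r \<in> carrier R \<Longrightarrow> a \<otimes> r \<in> I"
  shows "ideal I R"
  using assms by (intro ideal.intro ring_axioms ideal_axioms.intro) (auto simp: left_ideal_def)

lemma left_ideal_sum: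
  assumes I: "left_ideal R I" and J: "left_ideal R J"
  shows "left_ideal R {s \<oplus> t | s t. s \<in> I \<and> t \<in> J}"
proof (rule left_idealI)
  note cl = left_ideal_closed[OF I] left_ideal_closed[OF J]
  show "{s \<oplus> t | s t. s \<in> I \<and> t \<in> J} \<subseteq> carrier R" using cl(1,7) by blast
  have "\<zero> = \<zero> \<oplus> \<zero>" by simp
  then show "\<zero> \<in> {s \<oplus> t | s t. s \<in> I \<and> t \<in> J}" using cl(2,8) by blast
next
  note cl = left_ideal_closed[OF I] left_ideal_closed[OF J]
  fix a b assume "a \<in> {s \<oplus> t | s t. s \<in> I \<and> t \<in> J}" "b \<in> {s \<oplus> t | s t. s \<in> I \<and> t \<in> J}"
  then obtain s t s' t' where *: "a = s \<oplus> t" "b = s' \<oplus> t'" "s \<in> I" "s' \<in> I" "t \<in> J" "t' \<in> J" by blast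
  then have c: "s \<in> carrier R" "s' \<in> carrier R" "t \<in> carrier R" "t' \<in> carrier R" using cl(1,7) by auto
  then have "a \<oplus> b = (s \<oplus> s') \<oplus> (t \<oplus> t')" using * by (simp add: a_ac)
  then show "a \<oplus> b \<in> {s \<oplus> t | s t. s \<in> I \<and> t \<in> J}" using * cl(3,9) by blast
next
  note cl = left_ideal_closed[OF I] left_ideal_closed[OF J]
  fix a r assume "a \<in> {s \<oplus> t | s t. s \<in> I \<and> t \<in> J}" and r: "r \<in> carrier R"
  then obtain s t where *: "a = s \<oplus> t" "s \<in> I" "t \<in> J" by blast
  then have "r \<otimes> a = r \<otimes> s \<oplus> r \<otimes> t" using cl(1,7) r by (simp add: r_distr subset_iff)
  then show "r \<otimes> a \<in> {s \<oplus> t | s t. s \<in> I \<and> t \<in> J}" using * cl(6,12) r by blast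
qed

lemma left_ideal_mult_image:
  assumes I: "left_ideal R I" and c: "c \<in> carrier R"
  shows "left_ideal R {x \<otimes> c | x. x \<in> I}"
proof (rule left_idealI)
  note cl = left_ideal_closed[OF I]
  show "{x \<otimes> c | x. x \<in> I} \<subseteq> carrier R" using cl(1) c by auto
  have "\<zero> = \<zero> \<otimes> c" using c by simp
  then show "\<zero> \<in> {x \<otimes> c | x. x \<in> I}" using cl(2) by blast
next
  note cl = left_ideal_closed[OF I]
  fix a b assume "a \<in> {x \<otimes> c | x. x \<in> I}" "b \<in> {x \<otimes> c | x. x \<in> I}"
  then obtain x y where *: "a = x \<otimes> c" "b = y \<otimes> c" "x \<in> I" "y \<in> I" by blast
  then have "a \<oplus> b = (x \<oplus> y) \<otimes> c" using cl(1) c by (simp add: l_distr subset_iff)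
  then show "a \<oplus> b \<in> {x \<otimes> c | x. x \<in> I}" using * cl(3) by blast
next
  note cl = left_ideal_closed[OF I]
  fix a r assume "a \<in> {x \<otimes> c | x. x \<in> I}" and r: "r \<in> carrier R"
  then obtain x where *: "a = x \<otimes> c" "x \<in> I" by blast
  then have "r \<otimes> a = (r \<otimes> x) \<otimes> c" using cl(1) c r by (simp add: m_assoc subset_iff)
  then show "r \<otimes> a \<in> {x \<otimes> c | x. x \<in> I}" using * cl(6) r by blast
qed

lemma left_ideal_transporter:
  assumes I: "left_ideal R I" and c: "c \<in> carrier R"
  shows "left_ideal R {x \<in> carrier R. x \<otimes> c \<in> I}"
  by (rule left_idealI)
    (use left_ideal_closed[OF I] c in \<open>auto simp: l_distr m_assoc\<close>)

lemma left_ideal_carrier: "left_ideal R (carrier R)"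
  by (rule left_idealI) auto

lemma left_ideal_Int: "left_ideal R I \<Longrightarrow> left_ideal R J \<Longrightarrow> left_ideal R (I \<inter> J)"
  by (rule left_idealI) (auto dest: left_ideal_closed)

text \<open>Primeness is defined through ideals. Instead of the ideals generated by \<open>a\<close>
  and \<open>b\<close>, larger ones are used whose ideal axioms are immediate: \<open>I\<close>
  annihilates \<open>b\<close> modulo \<open>P\<close> from the left, and \<open>J\<close> is
  everything annihilated by \<open>I\<close>.\<close>

lemma nc_prime_mult:
  assumes P: "nc_prime_ideal R P" and ab: "a \<in> carrier R" "b \<in> carrier R"
    and *: "\<And>s. s \<in> carrier R \<Longrightarrow> a \<otimes> s \<otimes> b \<in> P"
  shows "a \<in> P \<or> b \<in> P"
proof -
  have idl: "ideal P R" using P by (simp add: nc_prime_ideal_def)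
  note cl = left_ideal_closed[OF ideal_left_ideal[OF idl]]
  define I where "I = {z \<in> carrier R. \<forall>s\<in>carrier R. z \<otimes> s \<otimes> b \<in> P}"
  define J where "J = {y \<in> carrier R. \<forall>z\<in>I. \<forall>s\<in>carrier R. z \<otimes> s \<otimes> y \<in> P}"
  have Ic: "z \<in> carrier R" if "z \<in> I" for z using that by (simp add: I_def)
  have "ideal I R"
  proof (rule idealI_left[OF left_idealI])
    show "I \<subseteq> carrier R" using Ic by blast
    show "\<zero> \<in> I" using cl(2) ab by (simp add: I_def)
    show "p \<oplus> q \<in> I" if "p \<in> I" "q \<in> I" for p q
      using that cl(3) ab by (simp add: I_def l_distr)
    show "r \<otimes> p \<in> I" if "p \<in> I" "r \<in> carrier R" for p r
    proof -
      have "r \<otimes> p \<otimes> s \<otimes> b = r \<otimes> (p \<otimes> s \<otimes> b)" if "s \<in> carrier R" for s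
        using that \<open>p \<in> I\<close> \<open>r \<in> carrier R\<close> ab Ic by (simp add: m_assoc)
      then show ?thesis using that cl(6) ab unfolding I_def by simp
    qed
    show "p \<otimes> r \<in> I" if "p \<in> I" "r \<in> carrier R" for p r
    proof -
      have "p \<otimes> r \<otimes> s \<otimes> b = p \<otimes> (r \<otimes> s) \<otimes> b" if "s \<in> carrier R" for s
        using that \<open>p \<in> I\<close> \<open>r \<in> carrier R\<close> ab Ic by (simp add: m_assoc)
      then show ?thesis using that ab unfolding I_def by simp
    qed
  qed
  moreover have "ideal J R"
  proof (rule idealI_left[OF left_idealI])
    show "J \<subseteq> carrier R" by (auto simp: J_def)
    show "\<zero> \<in> J" using cl(2) Ic by (simp add: J_def)
    show "p \<oplus> q \<in> J" if "p \<in> J" "q \<in> J" for p q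
      using that cl(3) Ic by (simp add: J_def r_distr)
    show "r \<otimes> p \<in> J" if "p \<in> J" "r \<in> carrier R" for p r
    proof -
      have "z \<otimes> s \<otimes> (r \<otimes> p) = z \<otimes> (s \<otimes> r) \<otimes> p" if "z \<in> I" "s \<in> carrier R" for z s
        using that \<open>p \<in> J\<close> \<open>r \<in> carrier R\<close> Ic by (simp add: m_assoc J_def)
      then show ?thesis using that unfolding J_def by simp
    qed
    show "p \<otimes> r \<in> J" if "p \<in> J" "r \<in> carrier R" for p r
    proof -
      have "z \<otimes> s \<otimes> (p \<otimes> r) = z \<otimes> s \<otimes> p \<otimes> r" if "z \<in> I" "s \<in> carrier R" for z s
        using that \<open>p \<in> J\<close> \<open>r \<in> carrier R\<close> Ic by (simp add: m_assoc J_def)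
      then show ?thesis using that ideal.I_r_closed[OF idl] unfolding J_def by simp
    qed
  qed
  moreover have "I \<cdot> J \<subseteq> P"
  proof
    fix z assume "z \<in> I \<cdot> J"
    then show "z \<in> P"
    proof (induction rule: ideal_prod.induct)
      case (prod i j)
      then have "i \<otimes> \<one> \<otimes> j \<in> P" unfolding J_def by blast
      then show ?case using prod Ic by simp
    qed (rule cl(3))
  qed
  ultimately have "I \<subseteq> P \<or> J \<subseteq> P" using P by (simp add: nc_prime_ideal_def)
  moreover have "a \<in> I" using ab * by (simp add: I_def)
  moreover have "b \<in> J" using ab by (simp add: I_def J_def)
  ultimately show ?thesis by blast
qed

lemma nc_prime_idealD:
  assumes "nc_prime_ideal R P"
  shows "ideal P R" "left_ideal R P" "\<one> \<notin> P"
proof -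
  show "ideal P R" using assms by (simp add: nc_prime_ideal_def)
  then show "left_ideal R P" by (rule ideal_left_ideal)
  show "\<one> \<notin> P" using assms ideal.one_imp_carrier unfolding nc_prime_ideal_def by blast
qed

text \<open>The part of Goldie's theorem that is needed, with everything read modulo the prime ideal
  instead of in the quotient ring.\<close>

lemma nil_imp_mem_prime:
  assumes acc: "acc {I. left_ideal R I}" and P: "nc_prime_ideal R P" and a: "a \<in> carrier R"
    and nil: "\<And>b. b \<in> carrier R \<Longrightarrow> \<exists>k::nat. (a \<otimes> b) [^] k \<in> P"
  shows "a \<in> P"
proof (rule ccontr)
  assume "a \<notin> P"
  note cl = left_ideal_closed[OF nc_prime_idealD(2)[OF P]]
  note rcl = ideal.I_r_closed[OF nc_prime_idealD(1)[OF P]]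
  \<comment> \<open>\<open>T\<close> is the set of counterexamples: elements outside
    \<open>P\<close> whose right multiples are all nilpotent modulo \<open>P\<close>. One with
    maximal left annihilator modulo \<open>P\<close> is chosen.\<close>
  define T where "T = {a \<in> carrier R. a \<notin> P \<and> (\<forall>b\<in>carrier R. \<exists>k::nat. (a \<otimes> b) [^] k \<in> P)}"
  define ann where "ann c = {z \<in> carrier R. z \<otimes> c \<in> P}" for c
  have "a \<in> T" using a nil \<open>a \<notin> P\<close> by (simp add: T_def)
  then have ne: "ann ` T \<noteq> {}" by blast
  have "ann ` T \<subseteq> {I. left_ideal R I}"
    using left_ideal_transporter[OF nc_prime_idealD(2)[OF P]] by (auto simp: T_def ann_def)
  from acc_maximal[OF acc this ne]
  obtain t where t: "t \<in> T" and max: "\<And>t'. t' \<in> T \<Longrightarrow> \<not> ann t \<subset> ann t'" by blast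
  have tc: "t \<in> carrier R" "t \<notin> P" using t by (auto simp: T_def)
  \<comment> \<open>This says that \<open>t\<close> generates a square-zero ideal modulo
    \<open>P\<close>, which primeness excludes. If \<open>w = t b\<close> is not in
    \<open>P\<close>, its last power \<open>w^m\<close> outside \<open>P\<close> is a right multiple
    of \<open>t\<close> and again a counterexample. By maximality it has the same annihilator as
    \<open>t\<close>, and \<open>w\<close> annihilates it.\<close>
  have "t \<otimes> b \<otimes> t \<in> P" if b: "b \<in> carrier R" for b
  proof (cases "t \<otimes> b \<in> P")
    case True
    then show ?thesis using tc rcl by simp
  next
    case False
    define w where "w = t \<otimes> b"
    have w: "w \<in> carrier R" using tc b by (simp add: w_def)
    have "\<exists>k::nat. w [^] k \<in> P" using t b by (simp add: T_def w_def)
    define k where "k = (LEAST k::nat. w [^] k \<in> P)"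
    have k: "w [^] k \<in> P" unfolding k_def using \<open>\<exists>k::nat. w [^] k \<in> P\<close> by (rule LeastI_ex)
    have "k \<noteq> 0" using k nc_prime_idealD(3)[OF P] by (metis nat_pow_0)
    then obtain m where m: "k = Suc m" by (cases k) auto
    have "m \<noteq> 0"
    proof
      assume "m = 0"
      then have "w \<in> P" using k m w by simp
      then show False using False by (simp add: w_def)
    qed
    then obtain l where l: "m = Suc l" by (cases m) auto
    have nP: "w [^] m \<notin> P"
      using not_less_Least[of m "\<lambda>k. w [^] k \<in> P"] m by (simp add: k_def)
    have wm: "w [^] m = t \<otimes> (b \<otimes> w [^] l)"
      unfolding l using nat_pow_Suc2[OF w, of l] tc b w by (simp add: w_def m_assoc)
    have "w [^] m \<in> T"
      unfolding T_def
    proof (intro CollectI conjI ballI)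
      show "w [^] m \<in> carrier R" using w by simp
      show "w [^] m \<notin> P" by (rule nP)
      fix b' assume b': "b' \<in> carrier R"
      have "w [^] m \<otimes> b' = t \<otimes> (b \<otimes> w [^] l \<otimes> b')" using wm tc b w b' by (simp add: m_assoc)
      moreover have "b \<otimes> w [^] l \<otimes> b' \<in> carrier R" using b w b' by simp
      ultimately show "\<exists>k::nat. (w [^] m \<otimes> b') [^] k \<in> P" using t unfolding T_def by simp
    qed
    moreover have "ann t \<subseteq> ann (w [^] m)"
    proof
      fix z assume z: "z \<in> ann t"
      then have "z \<otimes> t \<otimes> (b \<otimes> w [^] l) \<in> P" using rcl b w by (simp add: ann_def)
      then show "z \<in> ann (w [^] m)" using z tc b w unfolding wm by (simp add: ann_def m_assoc)
    qed
    ultimately have "ann t = ann (w [^] m)" using max by blast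
    moreover have "w \<in> ann (w [^] m)"
      using k w unfolding m by (simp add: ann_def flip: nat_pow_Suc2)
    ultimately have "w \<in> ann t" by blast
    then show ?thesis by (simp add: ann_def w_def)
  qed
  then have "t \<in> P" using nc_prime_mult[OF P tc(1) tc(1)] by blast
  then show False using tc by simp
qed

text \<open>A sufficiently high power of a non-nilpotent element has the same left annihilator
  modulo \<open>P\<close> as its square. The last property of \<open>a\<close> will make the sum
  with \<open>R a\<close> behave like a direct sum in the next lemma.\<close>

lemma left_ideal_non_nil:
  assumes acc: "acc {I. left_ideal R I}" and P: "nc_prime_ideal R P"
    and K: "left_ideal R K" "\<not> K \<subseteq> P"
  obtains a where "a \<in> K" "a \<notin> P" "\<And>z. z \<in> carrier R \<Longrightarrow> z \<otimes> a \<otimes> a \<in> P \<Longrightarrow> z \<otimes> a \<in> P"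
proof -
  note cl = left_ideal_closed[OF nc_prime_idealD(2)[OF P]]
  note rcl = ideal.I_r_closed[OF nc_prime_idealD(1)[OF P]]
  obtain b where b: "b \<in> K" "b \<notin> P" using K(2) by blast
  have bc: "b \<in> carrier R" using b left_ideal_closed(1)[OF K(1)] by blast
  obtain b' where b': "b' \<in> carrier R" "\<And>k::nat. (b \<otimes> b') [^] k \<notin> P"
    using nil_imp_mem_prime[OF acc P bc] b(2) by blast
  define w where "w = b' \<otimes> b"
  have w: "w \<in> carrier R" "w \<in> K" using b b' bc left_ideal_closed(6)[OF K(1)] by (auto simp: w_def)
  \<comment> \<open>Non-nilpotency is known for the right multiple \<open>b b'\<close>, but only the
    left multiple \<open>b' b\<close> is sure to lie in \<open>K\<close>; this identity transfers
    it.\<close>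
  have pow: "(b \<otimes> b') [^] Suc k = b \<otimes> w [^] k \<otimes> b'" for k :: nat
  proof (induction k)
    case 0
    show ?case using bc b' by simp
  next
    case (Suc k)
    have "(b \<otimes> b') [^] Suc (Suc k) = (b \<otimes> b') [^] Suc k \<otimes> (b \<otimes> b')" by (rule nat_pow_Suc)
    also have "\<dots> = b \<otimes> (w [^] k \<otimes> w) \<otimes> b'"
      unfolding Suc using bc b' w by (simp add: m_assoc w_def)
    finally show ?case by simp
  qed
  have wP: "w [^] k \<notin> P" for k :: nat
    using b'(2)[of "Suc k"] cl(6) rcl bc b'(1) unfolding pow by blast
  \<comment> \<open>The exponent \<open>Suc k\<close> ensures that the chosen power lies in
    \<open>K\<close> even when the annihilators are stable from the start.\<close>
  define ann where "ann k = {z \<in> carrier R. z \<otimes> w [^] Suc k \<in> P}" for k :: nat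
  have "\<exists>N. \<forall>i\<ge>N. ann i = ann N"
  proof (rule acc_stable[OF acc])
    show "ann i \<in> {I. left_ideal R I}" for i
      using left_ideal_transporter[OF nc_prime_idealD(2)[OF P]] w by (simp add: ann_def)
    show "ann i \<subseteq> ann (Suc i)" for i
    proof
      fix z assume z: "z \<in> ann i"
      then have "z \<otimes> w [^] Suc i \<otimes> w \<in> P" unfolding ann_def using rcl w(1) by blast
      then show "z \<in> ann (Suc i)" using z w by (simp add: ann_def m_assoc)
    qed
  qed
  then obtain N where N: "\<forall>i\<ge>N. ann i = ann N" by blast
  define a where "a = w [^] Suc N"
  have ac: "a \<in> carrier R" using w by (simp add: a_def)
  have "a \<otimes> a = w [^] Suc (Suc N + N)"
    unfolding a_def using nat_pow_mult[OF w(1), of "Suc N" "Suc N"] by simp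
  moreover have "ann (Suc N + N) = ann N" using N[rule_format, of "Suc N + N"] by simp
  ultimately have "z \<otimes> a \<in> P" if "z \<in> carrier R" "z \<otimes> a \<otimes> a \<in> P" for z
    using that ac unfolding ann_def a_def[symmetric] by (auto simp: m_assoc)
  moreover have "a \<in> K" unfolding a_def using left_ideal_closed(6)[OF K(1) w(2)] w by simp
  moreover have "a \<notin> P" using wP unfolding a_def by blast
  ultimately show ?thesis using that by blast
qed

text \<open>Enlarge step by step a left ideal \<open>S\<close> containing an element
  \<open>c\<close> that is regular on \<open>S\<close> modulo \<open>P\<close>. Maximality of
  \<open>S\<close> leaves \<open>c\<close> with no annihilator inside \<open>Q\<close> modulo
  \<open>P\<close>, and primeness extends this to the whole ring.\<close>

lemma exists_regular_mod_prime:
  assumes acc: "acc {I. left_ideal R I}" and P: "nc_prime_ideal R P"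
    and Q: "ideal Q R" "P \<subset> Q"
  obtains c where "c \<in> Q" "\<And>z. z \<in> carrier R \<Longrightarrow> z \<otimes> c \<in> P \<Longrightarrow> z \<in> P"
proof -
  note LP = nc_prime_idealD(2)[OF P] and LQ = ideal_left_ideal[OF Q(1)]
  note cl = left_ideal_closed[OF LP]
  note Qcl = left_ideal_closed[OF LQ]
  note rcl = ideal.I_r_closed[OF nc_prime_idealD(1)[OF P]]
  define good where "good S c \<longleftrightarrow> left_ideal R S \<and> P \<subseteq> S \<and> c \<in> Q \<and> c \<in> S \<and>
     (\<forall>s\<in>S. s \<otimes> c \<in> P \<longrightarrow> s \<in> P)" for S c
  have "good P \<zero>" unfolding good_def using LP cl Qcl by simp
  then have "{S. \<exists>c. good S c} \<noteq> {}" by blast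
  moreover have "{S. \<exists>c. good S c} \<subseteq> {S. left_ideal R S}" unfolding good_def by blast
  ultimately have "\<exists>S\<in>{S. \<exists>c. good S c}. \<forall>S'\<in>{S. \<exists>c. good S c}. \<not> S < S'"
    by (intro acc_maximal[OF acc])
  then obtain S c where "good S c" and max: "\<And>S' c'. good S' c' \<Longrightarrow> \<not> S \<subset> S'" by blast
  have S: "left_ideal R S" "P \<subseteq> S" "c \<in> Q" "c \<in> S" "\<And>s. s \<in> S \<Longrightarrow> s \<otimes> c \<in> P \<Longrightarrow> s \<in> P"
    using \<open>good S c\<close> by (auto simp: good_def)
  note Scl = left_ideal_closed[OF S(1)]
  have cc: "c \<in> carrier R" using S Scl by blast
  have ann: "left_ideal R {z \<in> carrier R. z \<otimes> c \<in> P}" by (rule left_ideal_transporter[OF LP cc])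
  \<comment> \<open>Otherwise the intersection supplies \<open>a\<close> with \<open>a c\<close> in
    \<open>P\<close>, and \<open>c + a\<close> is regular on the strictly larger left ideal
    \<open>S + R a\<close>.\<close>
  have sub: "{z \<in> carrier R. z \<otimes> c \<in> P} \<inter> Q \<subseteq> P"
  proof (rule ccontr)
    assume "\<not> ?thesis"
    then obtain a where "a \<in> {z \<in> carrier R. z \<otimes> c \<in> P} \<inter> Q" and a: "a \<notin> P"
      "\<And>z. z \<in> carrier R \<Longrightarrow> z \<otimes> a \<otimes> a \<in> P \<Longrightarrow> z \<otimes> a \<in> P"
      using left_ideal_non_nil[OF acc P left_ideal_Int[OF ann LQ]] by blast
    then have ac: "a \<in> carrier R" "a \<otimes> c \<in> P" "a \<in> Q" by auto
    define S' where "S' = {s \<oplus> t | s t. s \<in> S \<and> t \<in> {z \<otimes> a | z. z \<in> carrier R}}"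
    have S'I: "s \<oplus> z \<otimes> a \<in> S'" if "s \<in> S" "z \<in> carrier R" for s z
      using that by (auto simp: S'_def)
    have "left_ideal R S'"
      unfolding S'_def by (intro left_ideal_sum S left_ideal_mult_image left_ideal_carrier ac)
    moreover have "S \<subseteq> S'"
    proof
      fix s assume "s \<in> S"
      then show "s \<in> S'" using S'I[of s \<zero>] Scl(1) ac by auto
    qed
    moreover have "c \<oplus> a \<in> S'" using S'I[OF S(4), of \<one>] ac by simp
    moreover have "c \<oplus> a \<in> Q" using Qcl(3) S(3) ac by simp
    moreover have "t \<in> P" if tS': "t \<in> S'" and tP: "t \<otimes> (c \<oplus> a) \<in> P" for t
    proof -
      obtain s z where t: "t = s \<oplus> z \<otimes> a" "s \<in> S" "z \<in> carrier R" using tS' by (auto simp: S'_def)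
      have sc: "s \<in> carrier R" using t Scl(1) by blast
      have tc: "t \<in> carrier R" using t sc ac by simp
      have tca: "t \<otimes> c \<oplus> t \<otimes> a \<in> P" using tP tc cc ac by (simp add: r_distr)
      have zac: "z \<otimes> a \<otimes> c \<in> P" using cl(6)[OF ac(2), of z] t ac cc by (simp add: m_assoc)
      have tac: "t \<otimes> a \<otimes> c \<in> P" using cl(6)[OF ac(2), of t] tc ac cc by (simp add: m_assoc)
      \<comment> \<open>Multiplying \<open>t (c + a)\<close> by \<open>c\<close> on the right kills
        the part with \<open>a\<close>, since \<open>a c\<close> is in \<open>P\<close>. Regularity
        on \<open>S\<close> then separates \<open>t c\<close> from \<open>t a\<close>, and
        afterwards \<open>s\<close> from \<open>z a\<close>.\<close>
      have "(t \<otimes> c \<oplus> t \<otimes> a) \<otimes> c \<ominus> t \<otimes> a \<otimes> c \<in> P" using rcl[OF tca cc] tac by (rule cl(5))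
      moreover have "(t \<otimes> c \<oplus> t \<otimes> a) \<otimes> c \<ominus> t \<otimes> a \<otimes> c = t \<otimes> c \<otimes> c"
        using tc cc ac by (simp add: l_distr a_minus_def a_assoc r_neg)
      ultimately have "t \<otimes> c \<otimes> c \<in> P" by simp
      moreover have tc_eq: "t \<otimes> c = s \<otimes> c \<oplus> z \<otimes> a \<otimes> c" using t sc ac cc by (simp add: l_distr)
      then have "t \<otimes> c \<in> S" using Scl(3) Scl(6)[OF S(4) sc] zac S(2) by auto
      ultimately have tcP: "t \<otimes> c \<in> P" using S(5) by blast
      have "(t \<otimes> c \<oplus> t \<otimes> a) \<ominus> t \<otimes> c \<in> P" using tca tcP by (rule cl(5))
      moreover have "(t \<otimes> c \<oplus> t \<otimes> a) \<ominus> t \<otimes> c = t \<otimes> a"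
        using tc cc ac by (simp add: a_minus_def a_ac r_neg1 r_neg2 r_neg)
      ultimately have taP: "t \<otimes> a \<in> P" by simp
      have "t \<otimes> c \<ominus> z \<otimes> a \<otimes> c \<in> P" using tcP zac by (rule cl(5))
      moreover have "t \<otimes> c \<ominus> z \<otimes> a \<otimes> c = s \<otimes> c"
        unfolding tc_eq using t sc ac cc by (simp add: a_minus_def a_assoc r_neg)
      ultimately have sP: "s \<in> P" using S(5) t(2) by simp
      have "t \<otimes> a \<ominus> s \<otimes> a \<in> P" using taP rcl[OF sP ac(1)] by (rule cl(5))
      moreover have "t \<otimes> a \<ominus> s \<otimes> a = z \<otimes> a \<otimes> a"
        using t sc ac by (simp add: l_distr a_minus_def a_ac r_neg1 r_neg2 r_neg)
      ultimately have "z \<otimes> a \<in> P" using a(2) t(3) by simp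
      then show ?thesis using t sP cl(3) by simp
    qed
    ultimately have "good S' (c \<oplus> a)" using S(2) unfolding good_def by blast
    moreover have "a \<in> S'" using S'I[OF Scl(2), of \<one>] ac by simp
    moreover have "a \<notin> S" using S(5) ac a by blast
    ultimately show False using max \<open>S \<subseteq> S'\<close> by blast
  qed
  obtain q where q: "q \<in> Q" "q \<notin> P" using Q(2) by blast
  have qc: "q \<in> carrier R" using q Qcl(1) by blast
  \<comment> \<open>An annihilator \<open>z\<close> of \<open>c\<close> becomes one inside
    \<open>Q\<close> after multiplication by \<open>q s\<close>, so \<open>q R z\<close> lies in
    \<open>P\<close> with \<open>q\<close> outside \<open>P\<close>.\<close>
  have "z \<in> P" if z: "z \<in> carrier R" "z \<otimes> c \<in> P" for z
  proof -
    have "q \<otimes> s \<otimes> z \<in> P" if s: "s \<in> carrier R" for s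
    proof -
      have "q \<otimes> s \<otimes> z \<in> Q" using ideal.I_r_closed[OF Q(1)] q s z by simp
      moreover have "q \<otimes> s \<otimes> z \<otimes> c \<in> P"
        using cl(6)[OF z(2), of "q \<otimes> s"] qc s z cc by (simp add: m_assoc)
      moreover have "q \<otimes> s \<otimes> z \<in> carrier R" using qc s z by simp
      ultimately have "q \<otimes> s \<otimes> z \<in> {z \<in> carrier R. z \<otimes> c \<in> P} \<inter> Q" by simp
      then show ?thesis using sub by (rule subsetD[rotated])
    qed
    then have "q \<in> P \<or> z \<in> P" by (rule nc_prime_mult[OF P qc z(1)])
    then show ?thesis using q(2) by simp
  qed
  then show ?thesis using that S(3) by blast
qed

text \<open>The hypothesis concerns only left ideals above \<open>p 0\<close>, so that the induction
  can drop the lowest prime and lower \<open>k\<close> by one, replacing the poset above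
  \<open>P\<close> by the one above \<open>Q\<close>.\<close>

lemma prime_chain_length_less_dev:
  assumes acc: "acc {I. left_ideal R I}"
    and "\<And>i. i \<le> m \<Longrightarrow> nc_prime_ideal R (p i)" "\<And>i. i < m \<Longrightarrow> p i \<subset> p (Suc i)"
    and "dev_less k {I. left_ideal R I \<and> p 0 \<subseteq> I}"
  shows "m < k"
  using assms(2-)
proof (induction m arbitrary: p k)
  case 0
  have P: "nc_prime_ideal R (p 0)" using 0 by simp
  have "k \<noteq> 0"
  proof
    assume "k = 0"
    then have "trivial_poset {I. left_ideal R I \<and> p 0 \<subseteq> I}" using 0 by simp
    moreover have "p 0 \<in> {I. left_ideal R I \<and> p 0 \<subseteq> I}" using nc_prime_idealD[OF P] by simp
    moreover have "carrier R \<in> {I. left_ideal R I \<and> p 0 \<subseteq> I}" "p 0 \<subseteq> carrier R"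
      using left_ideal_carrier left_ideal_closed(1)[OF nc_prime_idealD(2)[OF P]] by auto
    ultimately have "p 0 = carrier R" unfolding trivial_poset_def by blast
    then show False using nc_prime_idealD(3)[OF P] by simp
  qed
  then show ?case by simp
next
  case (Suc m)
  define P where "P = p 0"
  define Q where "Q = p 1"
  have P: "nc_prime_ideal R P" and Q: "nc_prime_ideal R Q" and PQ: "P \<subset> Q"
    using Suc.prems(1)[of 0] Suc.prems(1)[of 1] Suc.prems(2)[of 0] by (auto simp: P_def Q_def)
  note LP = nc_prime_idealD(2)[OF P] and LQ = nc_prime_idealD(2)[OF Q]
  note cl = left_ideal_closed[OF LP] and Qcl = left_ideal_closed[OF LQ]
  obtain c where c: "c \<in> Q" "\<And>z. z \<in> carrier R \<Longrightarrow> z \<otimes> c \<in> P \<Longrightarrow> z \<in> P"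
    using exists_regular_mod_prime[OF acc P nc_prime_idealD(1)[OF Q] PQ] by blast
  have cc: "c \<in> carrier R" using c Qcl by blast
  have cpow: "z \<in> P" if "z \<in> carrier R" "z \<otimes> c [^] i \<in> P" for z and i :: nat
    using that
  proof (induction i arbitrary: z)
    case (Suc i)
    then have "z \<otimes> c [^] i \<otimes> c \<in> P" using cc by (simp add: m_assoc)
    then have "z \<otimes> c [^] i \<in> P" using c(2) Suc.prems(1) cc by simp
    then show ?case using Suc by blast
  qed simp
  \<comment> \<open>\<open>F i J\<close> is \<open>J c^i + P\<close>. For fixed \<open>i\<close> it
    embeds the left ideals above \<open>Q\<close> strictly into the \<open>i\<close>-th factor of
    the chain \<open>R c^i + P\<close>.\<close>
  define F where "F i J = {s \<oplus> t | s t. s \<in> {z \<otimes> c [^] i | z. z \<in> J} \<and> t \<in> P}"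
    for i :: nat and J
  have FI: "z \<otimes> c [^] i \<oplus> t \<in> F i J" if "z \<in> J" "t \<in> P" for z t i J
    using that unfolding F_def by blast
  have FE: "\<exists>z\<in>J. \<exists>t\<in>P. a = z \<otimes> c [^] i \<oplus> t" if "a \<in> F i J" for a i J
    using that unfolding F_def by blast
  have Fl: "left_ideal R (F i J)" if "left_ideal R J" for i J
    unfolding F_def by (intro left_ideal_sum left_ideal_mult_image LP that nat_pow_closed cc)
  have Fm: "F i J \<subseteq> F i J'" if "J \<subseteq> J'" for i J J'
    using that unfolding F_def by blast
  have Fstep: "F (Suc i) (carrier R) \<subseteq> F i J" if J: "Q \<subseteq> J" for i J
  proof
    fix a assume "a \<in> F (Suc i) (carrier R)"
    then obtain z t where a: "z \<in> carrier R" "t \<in> P" "a = z \<otimes> c [^] Suc i \<oplus> t" using FE by blast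
    have "a = (z \<otimes> c) \<otimes> c [^] i \<oplus> t"
      unfolding a(3) nat_pow_Suc2[OF cc] using a cc by (simp add: m_assoc)
    moreover have "z \<otimes> c \<in> J" using Qcl(6) c(1) a J by blast
    ultimately show "a \<in> F i J" using FI a(2) by blast
  qed
  have "k \<noteq> 0"
  proof
    assume "k = 0"
    then have "trivial_poset {I. left_ideal R I \<and> P \<subseteq> I}" using Suc.prems(3) by (simp add: P_def)
    then show False using LP LQ PQ unfolding trivial_poset_def by blast
  qed
  then obtain k' where k': "k = Suc k'" by (cases k) auto
  define L where "L = {I. left_ideal R I \<and> P \<subseteq> I}"
  have "dev_less (Suc k') L" using Suc.prems(3) unfolding k' L_def P_def .
  moreover have CL: "F i (carrier R) \<in> L" for i
  proof -
    have "t \<in> F i (carrier R)" if "t \<in> P" for t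
      using FI[of \<zero> "carrier R" t i] that cl(1) cc by auto
    then show ?thesis using Fl[OF left_ideal_carrier] unfolding L_def by blast
  qed
  moreover have "F (Suc i) (carrier R) \<subseteq> F i (carrier R)" for i
    by (rule Fstep[OF Qcl(1)])
  ultimately have "\<forall>\<^sub>F i in sequentially.
      dev_less k' (interval_in L (F (Suc i) (carrier R)) (F i (carrier R)))"
    unfolding dev_less.simps by (elim allE[of _ "\<lambda>i. F i (carrier R)"]) blast
  then obtain i where i: "dev_less k' (interval_in L (F (Suc i) (carrier R)) (F i (carrier R)))"
    by (auto simp: eventually_sequentially)
  have "dev_less k' {I. left_ideal R I \<and> Q \<subseteq> I}"
  proof (rule dev_less_strict_mono[OF i, where f = "F i"])
    fix J assume "J \<in> {I. left_ideal R I \<and> Q \<subseteq> I}"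
    then have J: "left_ideal R J" "Q \<subseteq> J" by auto
    have "F i J \<in> L"
      using Fl[OF J(1)] CL[of "Suc i"] Fstep[OF J(2)] unfolding L_def by blast
    then show "F i J \<in> interval_in L (F (Suc i) (carrier R)) (F i (carrier R))"
      using Fstep[OF J(2)] Fm[OF left_ideal_closed(1)[OF J(1)]] by (simp add: interval_in_def)
  next
    fix J J' assume "J \<in> {I. left_ideal R I \<and> Q \<subseteq> I}" "J' \<in> {I. left_ideal R I \<and> Q \<subseteq> I}"
      and lt: "J < J'"
    then have J: "left_ideal R J" "Q \<subseteq> J" "left_ideal R J'" by auto
    note Jcl = left_ideal_closed[OF J(1)] and J'cl = left_ideal_closed[OF J(3)]
    obtain b where b: "b \<in> J'" "b \<notin> J" using lt by blast
    have bc: "b \<in> carrier R" using b J'cl by blast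
    have "b \<otimes> c [^] i \<in> F i J'" using FI[OF b(1) cl(2), of i] bc cc by simp
    moreover have "b \<otimes> c [^] i \<notin> F i J"
    proof
      assume "b \<otimes> c [^] i \<in> F i J"
      then obtain z t where zt: "z \<in> J" "t \<in> P" "b \<otimes> c [^] i = z \<otimes> c [^] i \<oplus> t" using FE by blast
      then have zc: "z \<in> carrier R" "t \<in> carrier R" using Jcl(1) cl(1) by auto
      \<comment> \<open>Strictness comes from cancelling \<open>c^i\<close> modulo \<open>P\<close>:
        then \<open>b - z\<close> is in \<open>P\<close>, which lies in \<open>J\<close>.\<close>
      have "(b \<ominus> z) \<otimes> c [^] i = b \<otimes> c [^] i \<ominus> z \<otimes> c [^] i"
        using bc zc cc by (simp add: a_minus_def l_distr l_minus)
      also have "\<dots> = t" unfolding zt(3) using zc cc by (simp add: a_minus_def a_ac r_neg1 r_neg2 r_neg)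
      finally have "b \<ominus> z \<in> P" using cpow[of "b \<ominus> z" i] bc zc zt by simp
      then have "(b \<ominus> z) \<oplus> z \<in> J" using Jcl(3) zt(1) PQ J(2) by blast
      moreover have "(b \<ominus> z) \<oplus> z = b" using bc zc by (simp add: a_minus_def a_assoc l_neg)
      ultimately show False using b by simp
    qed
    ultimately show "F i J < F i J'" using Fm[of J J' i] lt by blast
  qed
  then have "m < k'"
    using Suc.IH[of "\<lambda>i. p (Suc i)" k'] Suc.prems(1,2) by (simp add: Q_def)
  then show ?case by (simp add: k')
qed

end


section \<open>Prime avoidance and Kronecker's theorem\<close>

context ring
begin

lemma ideal_sum:
  assumes I: "ideal I R" and J: "ideal J R"
  shows "ideal {s \<oplus> t | s t. s \<in> I \<and> t \<in> J} R"
proof (rule idealI_left)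
  note LI = ideal_left_ideal[OF I] and LJ = ideal_left_ideal[OF J]
  show "left_ideal R {s \<oplus> t | s t. s \<in> I \<and> t \<in> J}" by (rule left_ideal_sum[OF LI LJ])
  fix a r assume "a \<in> {s \<oplus> t | s t. s \<in> I \<and> t \<in> J}" and r: "r \<in> carrier R"
  then obtain s t where a: "a = s \<oplus> t" "s \<in> I" "t \<in> J" by blast
  then have "a \<otimes> r = s \<otimes> r \<oplus> t \<otimes> r"
    using r left_ideal_closed(1)[OF LI] left_ideal_closed(1)[OF LJ] by (simp add: l_distr subset_iff)
  then show "a \<otimes> r \<in> {s \<oplus> t | s t. s \<in> I \<and> t \<in> J}"
    using a ideal.I_r_closed[OF I _ r] ideal.I_r_closed[OF J _ r] by blast
qed

text \<open>Noetherian induction. If a proper \<open>I\<close> is not prime, it contains a product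
  of ideals \<open>J\<close> and \<open>K\<close> not contained in it; every prime above
  \<open>I\<close> lies above the strictly larger \<open>I + J\<close> or \<open>I + K\<close>, and
  the two finite sets are united.\<close>

lemma finitely_many_primes_below:
  assumes acc: "acc {I. left_ideal R I}" and I: "ideal I R"
  shows "\<exists>F. finite F \<and> (\<forall>Q\<in>F. nc_prime_ideal R Q) \<and>
    (\<forall>P. nc_prime_ideal R P \<longrightarrow> I \<subseteq> P \<longrightarrow> (\<exists>Q\<in>F. I \<subseteq> Q \<and> Q \<subseteq> P))"
  using acc_wf[OF acc] I
proof (induction I rule: wf_induct_rule)
  case (less I)
  note LI = ideal_left_ideal[OF less.prems]
  consider "nc_prime_ideal R I" | "I = carrier R"
    | J K where "ideal J R" "ideal K R" "I \<cdot> J \<subseteq> I" "J \<cdot> K \<subseteq> I" "\<not> J \<subseteq> I" "\<not> K \<subseteq> I"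
    using less.prems ideal_prod_inter[OF less.prems] unfolding nc_prime_ideal_def by blast
  then show ?case
  proof cases
    case 1
    then show ?thesis by (intro exI[of _ "{I}"]) simp
  next
    case 2
    have "\<not> I \<subseteq> P" if "nc_prime_ideal R P" for P
      using nc_prime_idealD(3)[OF that] 2 by auto
    then show ?thesis by (intro exI[of _ "{}"]) simp
  next
    case (3 J K)
    have bigger: "\<exists>F. finite F \<and> (\<forall>Q\<in>F. nc_prime_ideal R Q) \<and>
      (\<forall>P. nc_prime_ideal R P \<longrightarrow> I \<subseteq> P \<and> J \<subseteq> P \<longrightarrow> (\<exists>Q\<in>F. I \<subseteq> Q \<and> Q \<subseteq> P))"
      if J: "ideal J R" "\<not> J \<subseteq> I" for J
    proof -
      define S where "S = {s \<oplus> t | s t. s \<in> I \<and> t \<in> J}"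
      note LJ = ideal_left_ideal[OF J(1)]
      have S: "ideal S R" unfolding S_def by (rule ideal_sum[OF less.prems J(1)])
      have IS: "I \<subseteq> S"
      proof
        fix s assume "s \<in> I"
        then have "s = s \<oplus> \<zero>" using left_ideal_closed(1)[OF LI] by auto
        then show "s \<in> S" unfolding S_def using \<open>s \<in> I\<close> left_ideal_closed(2)[OF LJ] by blast
      qed
      have JS: "J \<subseteq> S"
      proof
        fix s assume "s \<in> J"
        then have "s = \<zero> \<oplus> s" using left_ideal_closed(1)[OF LJ] by auto
        then show "s \<in> S" unfolding S_def using \<open>s \<in> J\<close> left_ideal_closed(2)[OF LI] by blast
      qed
      have "(S, I) \<in> {(b, a). a \<in> {I. left_ideal R I} \<and> b \<in> {I. left_ideal R I} \<and> a < b}"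
        using LI ideal_left_ideal[OF S] IS JS J(2) by auto
      from less.IH[OF this S] obtain F where F: "finite F" "\<forall>Q\<in>F. nc_prime_ideal R Q"
        "\<And>P. nc_prime_ideal R P \<Longrightarrow> S \<subseteq> P \<Longrightarrow> \<exists>Q\<in>F. S \<subseteq> Q \<and> Q \<subseteq> P" by blast
      have "S \<subseteq> P" if "nc_prime_ideal R P" "I \<subseteq> P" "J \<subseteq> P" for P
        using left_ideal_closed(3)[OF nc_prime_idealD(2)[OF that(1)]] that unfolding S_def by blast
      then have "\<exists>Q\<in>F. I \<subseteq> Q \<and> Q \<subseteq> P" if "nc_prime_ideal R P" "I \<subseteq> P" "J \<subseteq> P" for P
        using F(3)[OF that(1)] order_trans[OF IS] that by meson
      then show ?thesis using F(1,2) by (intro exI[of _ F]) simp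
    qed
    obtain F where F: "finite F" "\<forall>Q\<in>F. nc_prime_ideal R Q"
      "\<And>P. nc_prime_ideal R P \<Longrightarrow> I \<subseteq> P \<Longrightarrow> J \<subseteq> P \<Longrightarrow> \<exists>Q\<in>F. I \<subseteq> Q \<and> Q \<subseteq> P"
      using bigger[OF 3(1,5)] by auto
    obtain G where G: "finite G" "\<forall>Q\<in>G. nc_prime_ideal R Q"
      "\<And>P. nc_prime_ideal R P \<Longrightarrow> I \<subseteq> P \<Longrightarrow> K \<subseteq> P \<Longrightarrow> \<exists>Q\<in>G. I \<subseteq> Q \<and> Q \<subseteq> P"
      using bigger[OF 3(2,6)] by auto
    have "J \<subseteq> P \<or> K \<subseteq> P" if "nc_prime_ideal R P" "I \<subseteq> P" for P
      using that(1)[unfolded nc_prime_ideal_def] 3(1,2) order_trans[OF 3(4) that(2)] by simp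
    then have "\<exists>Q\<in>F \<union> G. I \<subseteq> Q \<and> Q \<subseteq> P" if "nc_prime_ideal R P" "I \<subseteq> P" for P
      using F(3)[OF that] G(3)[OF that] that by (meson UnI1 UnI2)
    then show ?thesis using F(1,2) G(1,2) by (intro exI[of _ "F \<union> G"]) auto
  qed
qed

text \<open>Elements outside \<open>Q\<close> are multiplied with a suitable \<open>s\<close> in
  between, which keeps the product outside \<open>Q\<close> because \<open>Q\<close> is prime and
  inside each two-sided ideal already treated.\<close>

lemma exists_in_primes_not_in_prime:
  assumes "finite F" "nc_prime_ideal R Q" "\<And>P. P \<in> F \<Longrightarrow> ideal P R \<and> \<not> P \<subseteq> Q"
  shows "\<exists>z\<in>carrier R. z \<notin> Q \<and> (\<forall>P\<in>F. z \<in> P)"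
  using assms(1,3)
proof (induction F)
  case empty
  then show ?case using nc_prime_idealD(3)[OF assms(2)] by (intro bexI[of _ \<one>]) auto
next
  case (insert P F)
  then obtain z where z: "z \<in> carrier R" "z \<notin> Q" "\<forall>P\<in>F. z \<in> P" by auto
  have P: "ideal P R" using insert.prems by simp
  obtain q where q: "q \<in> P" "q \<notin> Q" using insert.prems by blast
  have qc: "q \<in> carrier R" using q left_ideal_closed(1)[OF ideal_left_ideal[OF P]] by blast
  obtain s where s: "s \<in> carrier R" "z \<otimes> s \<otimes> q \<notin> Q"
    using nc_prime_mult[OF assms(2) z(1) qc] z(2) q(2) by blast
  have "z \<otimes> s \<otimes> q \<in> P" using ideal.I_l_closed[OF P q(1)] z s by simp
  moreover have "z \<otimes> s \<otimes> q \<in> P'" if "P' \<in> F" for P'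
    using insert.prems[of P'] that z(3) ideal.I_r_closed[of P' R] s qc by simp
  ultimately show ?case using s z qc by (intro bexI[of _ "z \<otimes> s \<otimes> q"]) auto
qed

text \<open>Induction removing a minimal member \<open>Q\<close>: if the element found for the other
  primes lies in \<open>Q\<close>, it is corrected by a left multiple of \<open>v\<close> lying in
  all of them but not in \<open>Q\<close>.\<close>

lemma prime_avoidance:
  assumes "finite F" "\<And>Q. Q \<in> F \<Longrightarrow> nc_prime_ideal R Q" "\<And>Q. Q \<in> F \<Longrightarrow> v \<notin> Q"
    and uv: "u \<in> carrier R" "v \<in> carrier R"
  shows "\<exists>y\<in>carrier R. \<forall>Q\<in>F. u \<oplus> y \<otimes> v \<notin> Q"
  using assms(1-3)
proof (induction F rule: finite_psubset_induct)
  case (psubset F)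
  show ?case
  proof (cases "F = {}")
    case True
    then show ?thesis by auto
  next
    case False
    obtain Q where Q: "Q \<in> F" and min: "\<And>P. P \<in> F \<Longrightarrow> P \<subseteq> Q \<Longrightarrow> P = Q"
      using finite_has_minimal[OF psubset.hyps False] by metis
    have Qp: "nc_prime_ideal R Q" using psubset.prems Q by blast
    have "F - {Q} \<subset> F" using Q by blast
    then have "\<exists>y\<in>carrier R. \<forall>P\<in>F - {Q}. u \<oplus> y \<otimes> v \<notin> P"
      by (rule psubset.IH) (use psubset.prems in auto)
    then obtain y where y: "y \<in> carrier R" "\<And>P. P \<in> F - {Q} \<Longrightarrow> u \<oplus> y \<otimes> v \<notin> P" by blast
    define w where "w = u \<oplus> y \<otimes> v"
    have wc: "w \<in> carrier R" using y uv by (simp add: w_def)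
    show ?thesis
    proof (cases "w \<in> Q")
      case False
      then have "\<forall>P\<in>F. u \<oplus> y \<otimes> v \<notin> P" using y(2) unfolding w_def by blast
      then show ?thesis using y(1) by blast
    next
      case True
      \<comment> \<open>Minimality of \<open>Q\<close> is what makes an element of all other members
        outside \<open>Q\<close> available.\<close>
      have "ideal P R \<and> \<not> P \<subseteq> Q" if "P \<in> F - {Q}" for P
        using that min nc_prime_idealD(1) psubset.prems by blast
      then obtain z where z: "z \<in> carrier R" "z \<notin> Q" "\<forall>P\<in>F - {Q}. z \<in> P"
        using exists_in_primes_not_in_prime[OF _ Qp, of "F - {Q}"] psubset.hyps by blast
      obtain s where s: "s \<in> carrier R" "z \<otimes> s \<otimes> v \<notin> Q"
        using nc_prime_mult[OF Qp z(1) uv(2)] z(2) psubset.prems(2)[OF Q] by blast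
      define t where "t = z \<otimes> s \<otimes> v"
      have tc: "t \<in> carrier R" using z s uv by (simp add: t_def)
      have eq: "u \<oplus> (y \<oplus> z \<otimes> s) \<otimes> v = w \<oplus> t"
        using y z s uv by (simp add: w_def t_def l_distr a_assoc)
      have "w \<oplus> t \<notin> P" if P: "P \<in> F" for P
      proof
        assume wt: "w \<oplus> t \<in> P"
        have Pp: "nc_prime_ideal R P" using psubset.prems P by blast
        note Pcl = left_ideal_closed[OF nc_prime_idealD(2)[OF Pp]]
        show False
        proof (cases "P = Q")
          case True
          have "(w \<oplus> t) \<ominus> w \<in> P" using wt \<open>w \<in> Q\<close> True by (intro Pcl(5)) auto
          moreover have "(w \<oplus> t) \<ominus> w = t" using wc tc by (simp add: a_minus_def a_ac r_neg1 r_neg2 r_neg)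
          ultimately show False using s True unfolding t_def by simp
        next
          case False
          then have "z \<in> P" using z P by blast
          then have "t \<in> P" unfolding t_def
            using ideal.I_r_closed[OF nc_prime_idealD(1)[OF Pp]] s uv by simp
          with wt have "(w \<oplus> t) \<ominus> t \<in> P" by (rule Pcl(5))
          moreover have "(w \<oplus> t) \<ominus> t = w" using wc tc by (simp add: a_minus_def a_assoc r_neg)
          ultimately show False using y(2)[of P] P False unfolding w_def by simp
        qed
      qed
      then show ?thesis using eq y z s by (intro bexI[of _ "y \<oplus> z \<otimes> s"]) auto
    qed
  qed
qed

text \<open>Height at least \<open>m\<close> is stated as an explicit chain ending in
  \<open>P\<close>, ready for the bound on chains of primes.\<close>

lemma exists_prime_chain_below:
  assumes acc: "acc {I. left_ideal R I}"
    and "\<And>i. i \<in> {1..m} \<Longrightarrow> u i \<in> carrier R" and v: "v \<in> carrier R"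
  shows "\<exists>y. (\<forall>i\<in>{1..m}. y i \<in> carrier R) \<and>
    (\<forall>P. nc_prime_ideal R P \<longrightarrow> (\<forall>i\<in>{1..m}. u i \<oplus> y i \<otimes> v \<in> P) \<longrightarrow> v \<notin> P \<longrightarrow>
      (\<exists>p. (\<forall>i\<le>m. nc_prime_ideal R (p i)) \<and> (\<forall>i<m. p i \<subset> p (Suc i)) \<and> p m = P))"
  using assms(2)
proof (induction m)
  case 0
  have "\<exists>p. (\<forall>i\<le>0. nc_prime_ideal R (p i)) \<and> (\<forall>i<0. p i \<subset> p (Suc i)) \<and> p 0 = P"
    if "nc_prime_ideal R P" for P
    using that by (intro exI[of _ "\<lambda>_::nat. P"]) auto
  then show ?case by auto
next
  case (Suc m)
  then obtain y where y: "\<And>i. i \<in> {1..m} \<Longrightarrow> y i \<in> carrier R"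
    and chain: "\<And>P. nc_prime_ideal R P \<Longrightarrow> \<forall>i\<in>{1..m}. u i \<oplus> y i \<otimes> v \<in> P \<Longrightarrow> v \<notin> P \<Longrightarrow>
      \<exists>p. (\<forall>i\<le>m. nc_prime_ideal R (p i)) \<and> (\<forall>i<m. p i \<subset> p (Suc i)) \<and> p m = P"
    by (metis (no_types, lifting) atLeastAtMost_iff le_SucI)
  define W where "W = (\<lambda>i. u i \<oplus> y i \<otimes> v) ` {1..m}"
  have W: "W \<subseteq> carrier R" unfolding W_def using y v Suc.prems by auto
  obtain F where F: "finite F" "\<forall>Q\<in>F. nc_prime_ideal R Q"
    "\<And>P. nc_prime_ideal R P \<Longrightarrow> Idl W \<subseteq> P \<Longrightarrow> \<exists>Q\<in>F. Idl W \<subseteq> Q \<and> Q \<subseteq> P"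
    using finitely_many_primes_below[OF acc genideal_ideal[OF W]] by blast
  \<comment> \<open>Members of \<open>F\<close> containing \<open>v\<close> cannot be avoided, but
    they never lie below a prime omitting \<open>v\<close>.\<close>
  have "\<exists>z\<in>carrier R. \<forall>Q\<in>{Q\<in>F. v \<notin> Q}. u (Suc m) \<oplus> z \<otimes> v \<notin> Q"
    by (rule prime_avoidance) (use F v Suc.prems in auto)
  then obtain z where z: "z \<in> carrier R" "\<And>Q. Q \<in> F \<Longrightarrow> v \<notin> Q \<Longrightarrow> u (Suc m) \<oplus> z \<otimes> v \<notin> Q" by blast
  define y' where "y' = y(Suc m := z)"
  have "\<exists>p. (\<forall>i\<le>Suc m. nc_prime_ideal R (p i)) \<and> (\<forall>i<Suc m. p i \<subset> p (Suc i)) \<and> p (Suc m) = P"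
    if P: "nc_prime_ideal R P" "\<forall>i\<in>{1..Suc m}. u i \<oplus> y' i \<otimes> v \<in> P" "v \<notin> P" for P
  proof -
    have "W \<subseteq> P"
    proof
      fix w assume "w \<in> W"
      then obtain i where "i \<in> {1..m}" "w = u i \<oplus> y i \<otimes> v" by (auto simp: W_def)
      then show "w \<in> P" using P(2)[rule_format, of i] by (simp add: y'_def)
    qed
    then have "Idl W \<subseteq> P" by (rule genideal_minimal[OF nc_prime_idealD(1)[OF P(1)]])
    then obtain Q where Q: "Q \<in> F" "Idl W \<subseteq> Q" "Q \<subseteq> P" using F(3) P(1) by blast
    have "W \<subseteq> Q" using Q(2) genideal_self[OF W] by blast
    moreover have "v \<notin> Q" using P(3) Q(3) by blast
    ultimately obtain p where p: "\<forall>i\<le>m. nc_prime_ideal R (p i)" "\<forall>i<m. p i \<subset> p (Suc i)" "p m = Q"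
      using chain[of Q] F(2) Q(1) unfolding W_def by blast
    have "u (Suc m) \<oplus> z \<otimes> v \<in> P" using P(2)[rule_format, of "Suc m"] by (simp add: y'_def)
    then have "Q \<subset> P" using z(2)[OF Q(1) \<open>v \<notin> Q\<close>] Q(3) by blast
    then show ?thesis
      using p P(1) by (intro exI[of _ "p(Suc m := P)"]) (auto simp: less_Suc_eq le_Suc_eq)
  qed
  moreover have "\<forall>i\<in>{1..Suc m}. y' i \<in> carrier R" using y z by (auto simp: y'_def)
  ultimately show ?case by blast
qed

theorem noncommutative_Kronecker:
  assumes acc: "acc {I. left_ideal R I}" and dev: "dev_less m {I. left_ideal R I}"
    and u: "\<And>i. i \<in> {1..m} \<Longrightarrow> u i \<in> carrier R" and v: "v \<in> carrier R"
  shows "\<exists>y. (\<forall>i\<in>{1..m}. y i \<in> carrier R) \<and>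
    prime_closure R (u ` {1..m} \<union> {v}) = prime_closure R ((\<lambda>i. u i \<oplus> y i \<otimes> v) ` {1..m})"
proof -
  let ?chain = "\<lambda>P. \<exists>p. (\<forall>i\<le>m. nc_prime_ideal R (p i)) \<and> (\<forall>i<m. p i \<subset> p (Suc i)) \<and> p m = P"
  have "\<exists>y. (\<forall>i\<in>{1..m}. y i \<in> carrier R) \<and>
    (\<forall>P. nc_prime_ideal R P \<longrightarrow> (\<forall>i\<in>{1..m}. u i \<oplus> y i \<otimes> v \<in> P) \<longrightarrow> v \<notin> P \<longrightarrow> ?chain P)"
    by (rule exists_prime_chain_below[OF acc u v])
  then obtain y where y': "\<forall>i\<in>{1..m}. y i \<in> carrier R"
    and chain: "\<forall>P. nc_prime_ideal R P \<longrightarrow> (\<forall>i\<in>{1..m}. u i \<oplus> y i \<otimes> v \<in> P) \<longrightarrow> v \<notin> P \<longrightarrow> ?chain P"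
    by (elim exE conjE)
  have y: "y i \<in> carrier R" if "i \<in> {1..m}" for i using y' that by (rule bspec)
  have "u ` {1..m} \<union> {v} \<subseteq> P \<longleftrightarrow> (\<lambda>i. u i \<oplus> y i \<otimes> v) ` {1..m} \<subseteq> P"
    if P: "nc_prime_ideal R P" for P
  proof
    note cl = left_ideal_closed[OF nc_prime_idealD(2)[OF P]]
    assume "u ` {1..m} \<union> {v} \<subseteq> P"
    then show "(\<lambda>i. u i \<oplus> y i \<otimes> v) ` {1..m} \<subseteq> P" using cl(3,6) y by auto
  next
    note cl = left_ideal_closed[OF nc_prime_idealD(2)[OF P]]
    assume *: "(\<lambda>i. u i \<oplus> y i \<otimes> v) ` {1..m} \<subseteq> P"
    \<comment> \<open>Otherwise \<open>P\<close> is the top of a chain of \<open>m + 1\<close>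
      primes, contradicting the deviation bound.\<close>
    have "v \<in> P"
    proof (rule ccontr)
      assume "v \<notin> P"
      moreover have "\<forall>i\<in>{1..m}. u i \<oplus> y i \<otimes> v \<in> P" using * by blast
      ultimately have "?chain P" using chain P by simp
      then obtain p where p: "\<forall>i\<le>m. nc_prime_ideal R (p i)" "\<forall>i<m. p i \<subset> p (Suc i)"
        by (elim exE conjE)
      have "dev_less m {I. left_ideal R I \<and> p 0 \<subseteq> I}" by (rule dev_less_subset[OF dev]) auto
      then have "m < m" using p by (intro prime_chain_length_less_dev[OF acc, of m p]) auto
      then show False by simp
    qed
    moreover have "u i \<in> P" if i: "i \<in> {1..m}" for i
    proof -
      have "u i \<oplus> y i \<otimes> v \<in> P" using * i by blast
      then have "(u i \<oplus> y i \<otimes> v) \<ominus> y i \<otimes> v \<in> P" using cl(6)[OF \<open>v \<in> P\<close> y[OF i]] by (rule cl(5))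
      then show ?thesis using u[OF i] y[OF i] v by (simp add: a_minus_def a_assoc r_neg)
    qed
    ultimately show "u ` {1..m} \<union> {v} \<subseteq> P" by blast
  qed
  then have "{P. nc_prime_ideal R P \<and> u ` {1..m} \<union> {v} \<subseteq> P} =
    {P. nc_prime_ideal R P \<and> (\<lambda>i. u i \<oplus> y i \<otimes> v) ` {1..m} \<subseteq> P}" by blast
  then show ?thesis using y unfolding prime_closure_def by (intro exI[of _ y]) simp
qed

end


section \<open>Words in a bijective skew PBW extension\<close>

locale bijective_pbw = ring A for A :: "('a, 'b) ring_scheme" (structure) +
  fixes K :: "'a set" and n :: nat and x :: "nat \<Rightarrow> 'a"
  assumes pbw: "bijective_skew_PBW_extension A K n x"
begin

abbreviation "KR \<equiv> A\<lparr>carrier := K\<rparr>"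

definition words :: "nat list set" where
  "words = lists {1..n}"

lemma words_simps [simp]:
  "[] \<in> words" "i # w \<in> words \<longleftrightarrow> i \<in> {1..n} \<and> w \<in> words"
  "v @ w \<in> words \<longleftrightarrow> v \<in> words \<and> w \<in> words"
  by (auto simp: words_def)

lemma K_subring: "subring K A"
  using pbw by (simp add: bijective_skew_PBW_extension_def skew_PBW_extension_def)

lemmas K_closed = subringE(2,3,5,6,7)[OF K_subring]

lemma K_carrier [simp]: "r \<in> K \<Longrightarrow> r \<in> carrier A"
  using subringE(1)[OF K_subring] by blast

lemma ring_KR: "ring KR"
  by (rule subring_is_ring[OF K_subring])

lemma x_carrier: "i \<in> {1..n} \<Longrightarrow> x i \<in> carrier A"
  using pbw by (auto simp: bijective_skew_PBW_extension_def skew_PBW_extension_def)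

lemma Units_KR: "c \<in> Units KR \<Longrightarrow> c \<in> K \<and> (\<exists>d\<in>K. c \<otimes> d = \<one> \<and> d \<otimes> c = \<one> \<and> d \<in> Units KR)"
  by (auto simp: Units_def)

lemma one_Units_KR: "\<one> \<in> Units KR"
  using K_closed by (auto simp: Units_def)

lemma mult_Units_KR: "c \<in> Units KR \<Longrightarrow> d \<in> Units KR \<Longrightarrow> c \<otimes> d \<in> Units KR"
  using monoid.Units_m_closed[OF ring.is_monoid[OF ring_KR], of c d] by simp

text \<open>Surjectivity of \<open>\<sigma>\<close> moves coefficients from left to right;
  preservation of units lets reorderings take place behind further letters.\<close>

lemma twist:
  assumes "i \<in> {1..n}"
  obtains \<sigma> \<delta> where "\<And>r. r \<in> K \<Longrightarrow> \<sigma> r \<in> K" "\<And>r. r \<in> K \<Longrightarrow> \<delta> r \<in> K"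
    "\<And>r. r \<in> K \<Longrightarrow> x i \<otimes> r = \<sigma> r \<otimes> x i \<oplus> \<delta> r" "\<And>a. a \<in> K \<Longrightarrow> \<exists>r\<in>K. \<sigma> r = a"
    "\<And>c. c \<in> Units KR \<Longrightarrow> \<sigma> c \<in> Units KR"
proof -
  obtain \<sigma> \<delta> where hom: "\<sigma> \<in> ring_hom KR KR" and der: "skew_derivation KR \<sigma> \<delta>"
    and eq: "\<forall>r\<in>K. x i \<otimes> r = \<sigma> r \<otimes> x i \<oplus> \<delta> r" and bij: "bij_betw \<sigma> K K"
    using pbw assms unfolding bijective_skew_PBW_extension_def by blast
  have 1: "\<sigma> r \<in> K" if "r \<in> K" for r using ring_hom_closed[OF hom, of r] that by simp
  have 2: "\<delta> r \<in> K" if "r \<in> K" for r using der that by (auto simp: skew_derivation_def)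
  have 3: "\<exists>r\<in>K. \<sigma> r = a" if "a \<in> K" for a
    using bij_betw_imp_surj_on[OF bij] that by (metis imageE)
  have 4: "\<sigma> c \<in> Units KR" if c: "c \<in> Units KR" for c
  proof -
    obtain d where "c \<in> K" "d \<in> K" "c \<otimes> d = \<one>" "d \<otimes> c = \<one>" using Units_KR[OF c] by blast
    then have "\<sigma> c \<otimes> \<sigma> d = \<one>" "\<sigma> d \<otimes> \<sigma> c = \<one>"
      using ring_hom_mult[OF hom, of c d] ring_hom_mult[OF hom, of d c] ring_hom_one[OF hom] by auto
    then show ?thesis using 1 \<open>c \<in> K\<close> \<open>d \<in> K\<close> unfolding Units_def by auto
  qed
  show ?thesis by (rule that[of \<sigma> \<delta>]) (use 1 2 3 4 eq in \<open>simp_all only:\<close>)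
qed

section \<open>Left spans of words and their products\<close>

definition xw :: "nat list \<Rightarrow> 'a" where
  "xw w = foldr (\<lambda>i m. x i \<otimes> m) w \<one>"

lemma xw_Nil [simp]: "xw [] = \<one>" and xw_Cons [simp]: "xw (i # w) = x i \<otimes> xw w"
  by (simp_all add: xw_def)

lemma xw_carrier [simp]: "w \<in> words \<Longrightarrow> xw w \<in> carrier A"
  by (induction w) (auto simp: x_carrier)

lemma xw_carrier_subset: "v \<in> V \<Longrightarrow> V \<subseteq> words \<Longrightarrow> xw v \<in> carrier A"
  by (rule xw_carrier) (rule subsetD)

lemma xw_append: "v \<in> words \<Longrightarrow> w \<in> words \<Longrightarrow> xw (v @ w) = xw v \<otimes> xw w"
  by (induction v) (auto simp: x_carrier m_assoc)

text \<open>The left \<open>K\<close>-span of \<open>V\<close>, built one term at a time so that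
  rule induction replaces finite sums.\<close>

inductive_set wspan :: "nat list set \<Rightarrow> 'a set" for V where
  zero: "\<zero> \<in> wspan V"
| step: "r \<in> K \<Longrightarrow> v \<in> V \<Longrightarrow> f \<in> wspan V \<Longrightarrow> r \<otimes> xw v \<oplus> f \<in> wspan V"

lemma span_carrier: "f \<in> wspan V \<Longrightarrow> V \<subseteq> words \<Longrightarrow> f \<in> carrier A"
  by (induction rule: wspan.induct) (auto simp: xw_carrier_subset)

lemma span_mono: "f \<in> wspan V \<Longrightarrow> V \<subseteq> V' \<Longrightarrow> f \<in> wspan V'"
  by (induction rule: wspan.induct) (auto intro: wspan.intros)

lemma span_image:
  assumes "f \<in> wspan V" "V \<subseteq> words"
    and "\<phi> \<zero> = \<zero>" "\<And>a b. a \<in> carrier A \<Longrightarrow> b \<in> carrier A \<Longrightarrow> \<phi> (a \<oplus> b) = \<phi> a \<oplus> \<phi> b"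
    and "\<zero> \<in> S" "\<And>a b. a \<in> S \<Longrightarrow> b \<in> S \<Longrightarrow> a \<oplus> b \<in> S"
    and "\<And>r v. r \<in> K \<Longrightarrow> v \<in> V \<Longrightarrow> \<phi> (r \<otimes> xw v) \<in> S"
  shows "\<phi> f \<in> S"
  using assms(1)
proof (induction rule: wspan.induct)
  case zero
  then show ?case using assms by simp
next
  case (step r v f)
  then have "r \<otimes> xw v \<in> carrier A" "f \<in> carrier A"
    using assms(2) span_carrier xw_carrier_subset by auto
  then show ?case using assms(4,6,7) step by simp
qed

lemma span_add:
  assumes "f \<in> wspan V" "g \<in> wspan V" "V \<subseteq> words"
  shows "f \<oplus> g \<in> wspan V"
  using assms(1)
proof (induction rule: wspan.induct)
  case zero
  then show ?case using assms span_carrier by simp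
next
  case (step r v f)
  have "r \<otimes> xw v \<in> carrier A" "f \<in> carrier A" "g \<in> carrier A"
    using assms step span_carrier xw_carrier_subset by auto
  then have "(r \<otimes> xw v \<oplus> f) \<oplus> g = r \<otimes> xw v \<oplus> (f \<oplus> g)" by (simp add: a_assoc)
  then show ?case using step wspan.step by simp
qed

lemma span_word:
  assumes "r \<in> K" "v \<in> V" "V \<subseteq> words"
  shows "r \<otimes> xw v \<in> wspan V"
proof -
  have "r \<otimes> xw v \<oplus> \<zero> \<in> wspan V" by (rule wspan.step[OF assms(1,2) wspan.zero])
  moreover have "r \<otimes> xw v \<in> carrier A" using assms xw_carrier_subset by auto
  ultimately show ?thesis by simp
qed

lemma span_K_mult:
  assumes "f \<in> wspan V" "V \<subseteq> words" "s \<in> K"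
  shows "s \<otimes> f \<in> wspan V"
proof (rule span_image[OF assms(1,2), where \<phi> = "\<lambda>f. s \<otimes> f"])
  fix r v assume rv: "r \<in> K" "v \<in> V"
  then have "s \<otimes> (r \<otimes> xw v) = (s \<otimes> r) \<otimes> xw v" using assms xw_carrier_subset by (simp add: m_assoc)
  then show "s \<otimes> (r \<otimes> xw v) \<in> wspan V"
    using span_word[of "s \<otimes> r" v V] rv assms K_closed by simp
qed (use assms wspan.zero span_add in \<open>simp_all add: r_distr\<close>)

lemma span_neg: "f \<in> wspan V \<Longrightarrow> V \<subseteq> words \<Longrightarrow> \<ominus> f \<in> wspan V"
  using span_K_mult[of f V "\<ominus> \<one>"] span_carrier[of f V] K_closed by (simp add: l_minus)

lemma span_minus: "f \<in> wspan V \<Longrightarrow> g \<in> wspan V \<Longrightarrow> V \<subseteq> words \<Longrightarrow> f \<ominus> g \<in> wspan V"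
  unfolding a_minus_def by (intro span_add span_neg)

text \<open>Passing \<open>x i\<close> over a coefficient yields a longer word with coefficient
  \<open>\<sigma> r\<close> and the old word with coefficient \<open>\<delta> r\<close>; hence both
  \<open>v\<close> and \<open>i # v\<close> are required in \<open>V'\<close>.\<close>

lemma span_x_mult:
  assumes f: "f \<in> wspan V" and V: "V \<subseteq> words" "V' \<subseteq> words" and i: "i \<in> {1..n}"
    and sub: "\<And>v. v \<in> V \<Longrightarrow> v \<in> V' \<and> i # v \<in> V'"
  shows "x i \<otimes> f \<in> wspan V'"
proof (rule span_image[OF f V(1), where \<phi> = "\<lambda>f. x i \<otimes> f"])
  fix r v assume rv: "r \<in> K" "v \<in> V"
  obtain \<sigma> \<delta> where tw: "\<sigma> r \<in> K" "\<delta> r \<in> K" "x i \<otimes> r = \<sigma> r \<otimes> x i \<oplus> \<delta> r"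
    using twist[OF i] rv(1) by metis
  have c: "xw v \<in> carrier A" "x i \<in> carrier A" "r \<in> carrier A" "\<sigma> r \<in> carrier A" "\<delta> r \<in> carrier A"
    using rv V tw x_carrier[OF i] xw_carrier_subset by auto
  have "x i \<otimes> (r \<otimes> xw v) = (x i \<otimes> r) \<otimes> xw v" using c by (simp add: m_assoc)
  also have "\<dots> = \<sigma> r \<otimes> xw (i # v) \<oplus> \<delta> r \<otimes> xw v"
    unfolding tw(3) using c by (simp add: l_distr m_assoc)
  also have "\<dots> \<in> wspan V'"
    using tw sub[OF rv(2)] V(2) by (intro span_add span_word) auto
  finally show "x i \<otimes> (r \<otimes> xw v) \<in> wspan V'" .
qed (use V(2) wspan.zero span_add x_carrier[OF i] in \<open>simp_all add: r_distr\<close>)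

abbreviation shorter :: "nat \<Rightarrow> nat list set" where
  "shorter k \<equiv> {w \<in> words. length w < k}"

lemma xw_mult_K:
  assumes "w \<in> words" "r \<in> K"
  shows "\<exists>s\<in>K. \<exists>f\<in>wspan (shorter (length w)). xw w \<otimes> r = s \<otimes> xw w \<oplus> f"
  using assms(1)
proof (induction w)
  case Nil
  show ?case using assms(2) by (intro bexI[of _ r] bexI[of _ \<zero>]) (auto intro: wspan.zero)
next
  case (Cons i w)
  then have i: "i \<in> {1..n}" and w: "w \<in> words" by auto
  obtain s f where s: "s \<in> K" "f \<in> wspan (shorter (length w))" "xw w \<otimes> r = s \<otimes> xw w \<oplus> f"
    using Cons.IH[OF w] by blast
  obtain \<sigma> \<delta> where tw: "\<sigma> s \<in> K" "\<delta> s \<in> K" "x i \<otimes> s = \<sigma> s \<otimes> x i \<oplus> \<delta> s"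
    using twist[OF i] s(1) by metis
  have fc: "f \<in> carrier A" using span_carrier[OF s(2)] by blast
  define g where "g = \<delta> s \<otimes> xw w \<oplus> x i \<otimes> f"
  have "x i \<otimes> f \<in> wspan (shorter (length (i # w)))"
    by (rule span_x_mult[OF s(2) _ _ i]) (use i in auto)
  moreover have "\<delta> s \<otimes> xw w \<in> wspan (shorter (length (i # w)))"
    using tw w by (intro span_word) auto
  ultimately have g: "g \<in> wspan (shorter (length (i # w)))"
    unfolding g_def by (intro span_add) auto
  have c: "x i \<in> carrier A" "xw w \<in> carrier A" "s \<in> carrier A" "\<sigma> s \<in> carrier A" "\<delta> s \<in> carrier A" "r \<in> carrier A"
    using x_carrier[OF i] w s tw assms(2) by auto
  have "xw (i # w) \<otimes> r = x i \<otimes> (xw w \<otimes> r)" using c by (simp add: m_assoc)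
  also have "\<dots> = (x i \<otimes> s) \<otimes> xw w \<oplus> x i \<otimes> f" unfolding s(3) using c fc by (simp add: r_distr m_assoc)
  also have "\<dots> = \<sigma> s \<otimes> xw (i # w) \<oplus> g"
    unfolding tw(3) g_def using c fc by (simp add: l_distr m_assoc a_assoc)
  finally show ?case using tw(1) g by blast
qed

text \<open>Converse of \<open>xw_mult_K\<close>: the coefficient travels to the right through
  preimages under the twists.\<close>

lemma K_mult_xw:
  assumes "w \<in> words" "a \<in> K"
  shows "\<exists>r\<in>K. \<exists>f\<in>wspan (shorter (length w)). a \<otimes> xw w = xw w \<otimes> r \<oplus> f"
  using assms
proof (induction w arbitrary: a)
  case Nil
  then show ?case by (intro bexI[of _ a] bexI[of _ \<zero>]) (auto intro: wspan.zero)
next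
  case (Cons i w)
  then have i: "i \<in> {1..n}" and w: "w \<in> words" by auto
  \<comment> \<open>\<open>b\<close> is a preimage of \<open>a\<close> under
    \<open>\<sigma>\<close>, and \<open>t\<close> is \<open>\<delta> b\<close>.\<close>
  obtain b t where b: "b \<in> K" "t \<in> K" "x i \<otimes> b = a \<otimes> x i \<oplus> t"
    using twist[OF i] Cons.prems(2) by metis
  obtain r f where r: "r \<in> K" "f \<in> wspan (shorter (length w))" "b \<otimes> xw w = xw w \<otimes> r \<oplus> f"
    using Cons.IH[OF w b(1)] by blast
  have fc: "f \<in> carrier A" using span_carrier[OF r(2)] by blast
  define g where "g = x i \<otimes> f \<ominus> t \<otimes> xw w"
  have "x i \<otimes> f \<in> wspan (shorter (length (i # w)))"
    by (rule span_x_mult[OF r(2) _ _ i]) (use i in auto)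
  moreover have "t \<otimes> xw w \<in> wspan (shorter (length (i # w)))"
    using b w by (intro span_word) auto
  ultimately have g: "g \<in> wspan (shorter (length (i # w)))"
    unfolding g_def by (intro span_minus) auto
  have c: "x i \<in> carrier A" "xw w \<in> carrier A" "a \<in> carrier A" "b \<in> carrier A" "t \<in> carrier A" "r \<in> carrier A"
    using x_carrier[OF i] w b r Cons.prems by auto
  have "a \<otimes> x i = x i \<otimes> b \<ominus> t" unfolding b(3) using c by (simp add: a_minus_def a_assoc r_neg)
  then have "a \<otimes> xw (i # w) = (x i \<otimes> b \<ominus> t) \<otimes> xw w" using c by (simp flip: m_assoc)
  also have "\<dots> = x i \<otimes> (b \<otimes> xw w) \<ominus> t \<otimes> xw w"
    using c by (simp add: a_minus_def l_distr l_minus m_assoc)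
  also have "\<dots> = xw (i # w) \<otimes> r \<oplus> g"
    unfolding r(3) g_def using c fc by (simp add: a_minus_def r_distr m_assoc a_assoc)
  finally show ?case using r(1) g by blast
qed

lemma span_mult_K:
  assumes f: "f \<in> wspan V" and V: "V \<subseteq> words" and r: "r \<in> K"
    and down: "\<And>v. v \<in> V \<Longrightarrow> shorter (length v) \<subseteq> V"
  shows "f \<otimes> r \<in> wspan V"
proof (rule span_image[OF f V, where \<phi> = "\<lambda>f. f \<otimes> r"])
  fix s v assume sv: "s \<in> K" "v \<in> V"
  then have v: "v \<in> words" using V by blast
  obtain t g where t: "t \<in> K" "g \<in> wspan (shorter (length v))" "xw v \<otimes> r = t \<otimes> xw v \<oplus> g"
    using xw_mult_K[OF v r] by blast
  have g: "g \<in> wspan V" using span_mono[OF t(2) down[OF sv(2)]] .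
  then have gc: "g \<in> carrier A" using span_carrier V by blast
  have "s \<otimes> xw v \<otimes> r = s \<otimes> (xw v \<otimes> r)" using sv v r by (simp add: m_assoc)
  also have "\<dots> = (s \<otimes> t) \<otimes> xw v \<oplus> s \<otimes> g" unfolding t(3) using sv v t gc by (simp add: r_distr m_assoc)
  also have "\<dots> \<in> wspan V"
    using sv t g V K_closed by (intro span_add span_word span_K_mult) auto
  finally show "s \<otimes> xw v \<otimes> r \<in> wspan V" .
qed (use V r wspan.zero span_add in \<open>simp_all add: l_distr\<close>)

lemma span_mult_xw:
  assumes f: "f \<in> wspan V" and V: "V \<subseteq> words" "V' \<subseteq> words" and w: "w \<in> words"
    and sub: "\<And>v. v \<in> V \<Longrightarrow> v @ w \<in> V'"
  shows "f \<otimes> xw w \<in> wspan V'"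
proof (rule span_image[OF f V(1), where \<phi> = "\<lambda>f. f \<otimes> xw w"])
  fix s v assume sv: "s \<in> K" "v \<in> V"
  then have v: "v \<in> words" using V by blast
  have "s \<otimes> xw v \<otimes> xw w = s \<otimes> xw (v @ w)" using sv v w by (simp add: m_assoc xw_append)
  also have "\<dots> \<in> wspan V'" using sv sub V by (intro span_word) auto
  finally show "s \<otimes> xw v \<otimes> xw w \<in> wspan V'" .
qed (use V w wspan.zero span_add in \<open>simp_all add: l_distr\<close>)

section \<open>Reordering letters up to units and shorter words\<close>

definition weq :: "nat list \<Rightarrow> nat list \<Rightarrow> bool" where
  "weq v w \<longleftrightarrow> v \<in> words \<and> w \<in> words \<and> length v = length w \<and>
     (\<exists>c\<in>Units KR. \<exists>f\<in>wspan (shorter (length w)). xw v = c \<otimes> xw w \<oplus> f)"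

lemma weq_refl: "w \<in> words \<Longrightarrow> weq w w"
  unfolding weq_def using one_Units_KR
  by (intro conjI bexI[of _ \<one>] bexI[of _ \<zero>]) (simp_all add: wspan.zero)

lemma weq_sym:
  assumes "weq v w" shows "weq w v"
proof -
  obtain c f where vw: "v \<in> words" "w \<in> words" "length v = length w"
    and c: "c \<in> Units KR" and f: "f \<in> wspan (shorter (length w))" and eq: "xw v = c \<otimes> xw w \<oplus> f"
    using assms unfolding weq_def by blast
  obtain d where d: "d \<in> K" "d \<in> Units KR" "d \<otimes> c = \<one>" and cK: "c \<in> K" using Units_KR[OF c] by blast
  have fc: "f \<in> carrier A" using span_carrier[OF f] by blast
  have "d \<otimes> xw v \<oplus> \<ominus> (d \<otimes> f) = (d \<otimes> c) \<otimes> xw w \<oplus> (d \<otimes> f \<oplus> \<ominus> (d \<otimes> f))"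
    unfolding eq using vw cK d(1) fc by (simp add: r_distr m_assoc a_assoc)
  also have "\<dots> = xw w" using vw d fc by (simp add: r_neg)
  finally have "xw w = d \<otimes> xw v \<oplus> \<ominus> (d \<otimes> f)" by simp
  moreover have "\<ominus> (d \<otimes> f) \<in> wspan (shorter (length v))"
    unfolding vw(3) using f d(1) by (intro span_neg span_K_mult) auto
  ultimately show ?thesis unfolding weq_def using vw d(2) by auto
qed

lemma weq_trans:
  assumes "weq u v" "weq v w" shows "weq u w"
proof -
  obtain c f where uv: "u \<in> words" "v \<in> words" "length u = length v"
    and c: "c \<in> Units KR" and f: "f \<in> wspan (shorter (length v))" and eq: "xw u = c \<otimes> xw v \<oplus> f"
    using assms(1) unfolding weq_def by blast
  obtain d g where vw: "w \<in> words" "length v = length w"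
    and d: "d \<in> Units KR" and g: "g \<in> wspan (shorter (length w))" and eq': "xw v = d \<otimes> xw w \<oplus> g"
    using assms(2) unfolding weq_def by blast
  have cd: "c \<in> K" "d \<in> K" using Units_KR c d by auto
  have "f \<in> carrier A" "g \<in> carrier A" using span_carrier[OF f] span_carrier[OF g] by auto
  then have "xw u = (c \<otimes> d) \<otimes> xw w \<oplus> (c \<otimes> g \<oplus> f)"
    unfolding eq eq' using cd vw by (simp add: r_distr m_assoc a_assoc)
  moreover have "c \<otimes> g \<oplus> f \<in> wspan (shorter (length w))"
    using f g cd vw(2) by (intro span_add span_K_mult) auto
  ultimately show ?thesis
    unfolding weq_def using uv vw mult_Units_KR[OF c d] by auto
qed

lemma weq_Cons:
  assumes "weq v w" and i: "i \<in> {1..n}"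
  shows "weq (i # v) (i # w)"
proof -
  obtain c f where vw: "v \<in> words" "w \<in> words" "length v = length w"
    and c: "c \<in> Units KR" and f: "f \<in> wspan (shorter (length w))" and eq: "xw v = c \<otimes> xw w \<oplus> f"
    using assms unfolding weq_def by blast
  have cK: "c \<in> K" using Units_KR[OF c] by simp
  obtain \<sigma> \<delta> where tw: "\<sigma> c \<in> K" "\<delta> c \<in> K" "x i \<otimes> c = \<sigma> c \<otimes> x i \<oplus> \<delta> c" "\<sigma> c \<in> Units KR"
    using twist[OF i] cK c by metis
  have fc: "f \<in> carrier A" using span_carrier[OF f] by blast
  have cc: "x i \<in> carrier A" "xw w \<in> carrier A" "c \<in> carrier A" "\<sigma> c \<in> carrier A" "\<delta> c \<in> carrier A"
    using x_carrier[OF i] vw cK tw by auto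
  define g where "g = \<delta> c \<otimes> xw w \<oplus> x i \<otimes> f"
  have "x i \<otimes> f \<in> wspan (shorter (length (i # w)))"
    by (rule span_x_mult[OF f _ _ i]) (use i in auto)
  moreover have "\<delta> c \<otimes> xw w \<in> wspan (shorter (length (i # w)))"
    using tw vw by (intro span_word) auto
  ultimately have g: "g \<in> wspan (shorter (length (i # w)))"
    unfolding g_def by (intro span_add) auto
  have "xw (i # v) = (x i \<otimes> c) \<otimes> xw w \<oplus> x i \<otimes> f"
    using cc fc by (simp add: eq r_distr m_assoc)
  also have "\<dots> = \<sigma> c \<otimes> xw (i # w) \<oplus> g"
    unfolding tw(3) g_def using cc fc by (simp add: l_distr m_assoc a_assoc)
  finally show ?thesis unfolding weq_def using vw i tw(4) g by auto
qed

lemma linear_part_span: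
  assumes "f \<in> pbw_linear_part A K n x"
  shows "f \<in> wspan (shorter 2)"
proof -
  obtain b g where b: "b \<in> K" and g: "g \<in> {1..n} \<rightarrow> K"
    and f: "f = b \<oplus> (\<Oplus>k\<in>{1..n}. g k \<otimes> x k)"
    using assms by (auto simp: pbw_linear_part_def)
  have "(\<Oplus>k\<in>B. g k \<otimes> x k) \<in> wspan (shorter 2)" if "finite B" "B \<subseteq> {1..n}" for B
    using that
  proof (induction B)
    case empty
    show ?case by (simp add: wspan.zero)
  next
    case (insert k B)
    have k: "k \<in> {1..n}" "g k \<in> K" using insert g by auto
    have "g k \<otimes> xw [k] \<in> wspan (shorter 2)" using k by (intro span_word) auto
    then have "g k \<otimes> x k \<in> wspan (shorter 2)" using x_carrier k by simp
    moreover have "g j \<otimes> x j \<in> carrier A" if "j \<in> insert k B" for j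
    proof -
      have "j \<in> {1..n}" using that insert.prems by blast
      then show ?thesis using funcset_mem[OF g] x_carrier by simp
    qed
    then have "(\<Oplus>k\<in>insert k B. g k \<otimes> x k) = g k \<otimes> x k \<oplus> (\<Oplus>k\<in>B. g k \<otimes> x k)"
      by (intro finsum_insert) (use insert in auto)
    moreover have "(\<Oplus>k\<in>B. g k \<otimes> x k) \<in> wspan (shorter 2)" using insert by blast
    ultimately show ?case by (simp only:) (rule span_add, auto)
  qed
  moreover have "b \<otimes> xw [] \<in> wspan (shorter 2)" using b by (intro span_word) auto
  ultimately show ?thesis unfolding f using b by (intro span_add) auto
qed

text \<open>The remainder of the commutation relation uses words of length at most one, so after
  appending \<open>w\<close> it stays shorter than the swapped word.\<close>

lemma weq_swap:
  assumes ij: "i \<in> {1..n}" "j \<in> {1..n}" "i < j" and w: "w \<in> words"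
  shows "weq (j # i # w) (i # j # w)"
proof -
  obtain c where c: "c \<in> Units KR" and "x j \<otimes> x i \<ominus> c \<otimes> x i \<otimes> x j \<in> pbw_linear_part A K n x"
    using pbw ij unfolding bijective_skew_PBW_extension_def by blast
  define f where "f = x j \<otimes> x i \<ominus> c \<otimes> x i \<otimes> x j"
  have f: "f \<in> wspan (shorter 2)" unfolding f_def by (rule linear_part_span) fact
  have cK: "c \<in> K" using Units_KR[OF c] by simp
  have cc: "x i \<in> carrier A" "x j \<in> carrier A" "xw w \<in> carrier A" "c \<in> carrier A" "f \<in> carrier A"
    using x_carrier ij w cK span_carrier[OF f] by auto
  have "x j \<otimes> x i = c \<otimes> x i \<otimes> x j \<oplus> f"
    unfolding f_def using cc by (simp add: a_minus_def a_ac r_neg1 r_neg2 r_neg)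
  then have "xw (j # i # w) = (c \<otimes> x i \<otimes> x j \<oplus> f) \<otimes> xw w" using cc by (simp flip: m_assoc)
  also have "\<dots> = c \<otimes> xw (i # j # w) \<oplus> f \<otimes> xw w" using cc by (simp add: l_distr m_assoc)
  finally have "xw (j # i # w) = c \<otimes> xw (i # j # w) \<oplus> f \<otimes> xw w" .
  moreover have "f \<otimes> xw w \<in> wspan (shorter (length (i # j # w)))"
    by (rule span_mult_xw[OF f _ _ w]) (use w in auto)
  ultimately show ?thesis unfolding weq_def using ij w c by auto
qed

lemma weq_insort:
  assumes "w \<in> words" "i \<in> {1..n}"
  shows "weq (i # w) (insort i w)"
  using assms(1)
proof (induction w)
  case Nil
  then show ?case using weq_refl assms(2) by simp
next
  case (Cons j w)
  then have j: "j \<in> {1..n}" and w: "w \<in> words" by auto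
  show ?case
  proof (cases "i \<le> j")
    case True
    then show ?thesis using weq_refl Cons.prems assms(2) by simp
  next
    case False
    have "weq (i # j # w) (j # i # w)" using weq_swap j w assms(2) False by simp
    moreover have "weq (j # i # w) (j # insort i w)" by (rule weq_Cons[OF Cons.IH[OF w] j])
    ultimately show ?thesis using False weq_trans by simp
  qed
qed

lemma weq_sort:
  assumes "w \<in> words"
  shows "weq w (sort w)"
  using assms
proof (induction w)
  case Nil
  then show ?case using weq_refl by simp
next
  case (Cons i w)
  then have i: "i \<in> {1..n}" and w: "w \<in> words" by auto
  have "weq (i # w) (i # sort w)" by (rule weq_Cons[OF Cons.IH[OF w] i])
  moreover have "weq (i # sort w) (insort i (sort w))"
    using w by (intro weq_insort i) (simp add: words_def in_lists_conv_set)
  ultimately show ?case using weq_trans by simp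
qed

text \<open>Both words are equivalent to their common sorted form, reached by insertion
  sort.\<close>

lemma weq_mset:
  assumes "mset v = mset w" "v \<in> words"
  shows "weq v w"
proof -
  have "w \<in> words" using assms mset_eq_setD by (auto simp: words_def in_lists_conv_set)
  moreover have "sort v = sort w" using assms(1) by (metis properties_for_sort mset_sort sorted_sort)
  ultimately show ?thesis using weq_sort assms(2) weq_trans weq_sym by metis
qed

end


section \<open>Leading coefficients of left ideals\<close>

text \<open>Translation invariance of the exponent order: the lists have equal length, and adding
  the same exponents leaves the first difference in place.\<close>

lemma lenlex_map_add:
  "(map f js, map g js) \<in> lenlex less_than \<Longrightarrow>
   (map (\<lambda>j. f j + h j :: nat) js, map (\<lambda>j. g j + h j) js) \<in> lenlex less_than"
  by (induction js) (auto simp: Cons_lenlex_iff)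

text \<open>The sorted word with exponent list \<open>l\<close>, whose first letter index is
  \<open>i\<close>; the offset serves the recursion and is \<open>1\<close> for monomials of
  \<open>A\<close>.\<close>

primrec exponent_word :: "nat list \<Rightarrow> nat \<Rightarrow> nat list" where
  "exponent_word [] i = []"
| "exponent_word (a # l) i = replicate a i @ exponent_word l (Suc i)"

lemma set_exponent_word: "set (exponent_word l i) \<subseteq> {i..<i + length l}"
proof (induction l arbitrary: i)
  case (Cons a l)
  then show ?case using Cons.IH[of "Suc i"] by auto
qed simp

lemma mset_exponent_word_mono:
  "list_all2 (\<le>) l l' \<Longrightarrow> mset (exponent_word l i) \<subseteq># mset (exponent_word l' i)"
proof (induction arbitrary: i rule: list_all2_induct)
  case (Cons a l b l')
  have "mset (replicate a i) \<subseteq># mset (replicate b i)"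
    using Cons.hyps by (simp add: subseteq_mset_def)
  from subset_mset.add_mono[OF this Cons.IH] show ?case by simp
qed simp

lemma count_exponent_word:
  "count (mset (exponent_word (map f [i..<i + k]) i)) j = (if i \<le> j \<and> j < i + k then f j else 0)"
proof (induction k arbitrary: i)
  case (Suc k)
  have "[i..<i + Suc k] = i # [Suc i..<Suc i + k]" by (simp add: upt_conv_Cons)
  then show ?case using Suc.IH[of "Suc i"] by (auto simp: not_less_eq_eq)
qed simp

context bijective_pbw
begin

lemma exponent_word_words: "length l = n \<Longrightarrow> exponent_word l 1 \<in> words"
  using set_exponent_word[of l 1] by (auto simp: words_def in_lists_conv_set)

lemma words_exponent_word:
  assumes "w \<in> words"
  obtains l where "length l = n" "mset (exponent_word l 1) = mset w"
proof (rule that[of "map (count (mset w)) [1..<1 + n]"])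
  show "mset (exponent_word (map (count (mset w)) [1..<1 + n]) 1) = mset w"
  proof (rule multiset_eqI)
    fix j
    have "count (mset w) j = 0" if "\<not> (1 \<le> j \<and> j < 1 + n)"
      using that assms by (auto simp: words_def in_lists_conv_set count_eq_zero_iff)
    then show "count (mset (exponent_word (map (count (mset w)) [1..<1 + n]) 1)) j = count (mset w) j"
      unfolding count_exponent_word by auto
  qed
qed simp

text \<open>Compared by \<open>lenlex less_than\<close>, these lists give the degree lexicographic order on exponents.\<close>

definition deg_exp :: "nat list \<Rightarrow> nat list" where
  "deg_exp w = length w # map (count (mset w)) [1..<Suc n]"

definition below :: "nat list \<Rightarrow> nat list set" where
  "below w = {v \<in> words. (deg_exp v, deg_exp w) \<in> lenlex less_than}"

lemma below_words: "below w \<subseteq> words"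
  by (auto simp: below_def)

lemma deg_exp_mset: "mset v = mset w \<Longrightarrow> deg_exp v = deg_exp w"
  using mset_eq_length[of v w] by (simp add: deg_exp_def)

lemma mset_deg_exp:
  assumes "deg_exp v = deg_exp w" "v \<in> words" "w \<in> words"
  shows "mset v = mset w"
proof (rule multiset_eqI)
  fix j
  show "count (mset v) j = count (mset w) j"
  proof (cases "j \<in> {1..n}")
    case True
    then show ?thesis using assms(1) by (auto simp: deg_exp_def)
  next
    case False
    then have "j \<notin> set v" "j \<notin> set w" using assms(2,3) by (auto simp: words_def in_lists_conv_set)
    then show ?thesis by (metis count_mset_0_iff)
  qed
qed

text \<open>Degree is compared first, so every remainder produced by moving coefficients or
  reordering letters lies below.\<close>

lemma shorter_below: "shorter (length w) \<subseteq> below w"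
  by (auto simp: below_def deg_exp_def Cons_lenlex_iff)

lemma below_length: "v \<in> below w \<Longrightarrow> length v \<le> length w"
  by (auto simp: below_def deg_exp_def Cons_lenlex_iff dest: lenlex_length)

lemma below_trans: "u \<in> below v \<Longrightarrow> v \<in> below w \<Longrightarrow> u \<in> below w"
  unfolding below_def using lenlex_trans[OF _ _ trans_less_than] by blast

lemma below_Cons:
  assumes "v \<in> below w" "i \<in> {1..n}"
  shows "i # v \<in> below (i # w)"
proof -
  define h where "h j = (if i = j then 1 else 0 :: nat)" for j
  define js where "js = [1..<Suc n]"
  have incr: "map (count (mset (i # w))) js = map (\<lambda>j. count (mset w) j + h j) js" for w
    by (simp add: h_def)
  have "length v < length w \<or> length v = length w \<and>
    (map (count (mset v)) js, map (count (mset w)) js) \<in> lenlex less_than"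
    using assms(1) unfolding below_def deg_exp_def js_def[symmetric] by (simp add: Cons_lenlex_iff)
  then have "length v < length w \<or> length v = length w \<and>
    (map (count (mset (i # v))) js, map (count (mset (i # w))) js) \<in> lenlex less_than"
    unfolding incr using lenlex_map_add[of "count (mset v)" js "count (mset w)" h] by metis
  then have "(deg_exp (i # v), deg_exp (i # w)) \<in> lenlex less_than"
    unfolding deg_exp_def js_def[symmetric] Cons_lenlex_iff by simp
  then show ?thesis using assms by (simp add: below_def)
qed

lemma below_span_mult_K: "f \<in> wspan (below w) \<Longrightarrow> r \<in> K \<Longrightarrow> f \<otimes> r \<in> wspan (below w)"
proof (rule span_mult_K[OF _ below_words])
  fix v assume "v \<in> below w"
  then show "shorter (length v) \<subseteq> below w"
    using below_length[of v w] shorter_below[of w] by auto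
qed

lemma below_span_x_mult:
  assumes "f \<in> wspan (below w)" "i \<in> {1..n}" "w \<in> words"
  shows "x i \<otimes> f \<in> wspan (below (i # w))"
proof (rule span_x_mult[OF assms(1) below_words below_words assms(2)])
  fix v assume v: "v \<in> below w"
  have "w \<in> below (i # w)" using shorter_below[of "i # w"] assms(3) by auto
  then show "v \<in> below (i # w) \<and> i # v \<in> below (i # w)"
    using below_trans[OF v] below_Cons[OF v assms(2)] by blast
qed

text \<open>Coefficients are written on the right of the leading word, so that these sets form an
  increasing family under multiplication by the variables without any twist.\<close>

definition lead_ideal :: "nat list \<Rightarrow> 'a set \<Rightarrow> 'a set" where
  "lead_ideal w I = {r \<in> K. \<exists>a\<in>I. \<exists>m\<in>wspan (below w). xw w \<otimes> r = a \<oplus> m}"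

lemma below_span_carrier: "f \<in> wspan (below w) \<Longrightarrow> f \<in> carrier A"
  by (rule span_carrier[OF _ below_words])

lemma shorter_span_below: "f \<in> wspan (shorter (length w)) \<Longrightarrow> f \<in> wspan (below w)"
  by (rule span_mono[OF _ shorter_below])

lemmas below_span_closed =
  span_add[OF _ _ below_words] span_minus[OF _ _ below_words] span_K_mult[OF _ below_words]

lemma left_ideal_lead_ideal:
  assumes w: "w \<in> words" and I: "left_ideal A I"
  shows "left_ideal KR (lead_ideal w I)"
proof -
  interpret KR: ring KR by (rule ring_KR)
  note Icl = left_ideal_closed[OF I]
  show ?thesis
  proof (rule KR.left_idealI)
    show "lead_ideal w I \<subseteq> carrier KR" by (auto simp: lead_ideal_def)
    show "\<zero>\<^bsub>KR\<^esub> \<in> lead_ideal w I"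
      using K_closed Icl(2) w
      by (auto simp: lead_ideal_def intro!: bexI[of _ \<zero>] intro: wspan.zero)
  next
    fix r s assume "r \<in> lead_ideal w I" "s \<in> lead_ideal w I"
    then obtain a m b m' where rs: "r \<in> K" "s \<in> K" "a \<in> I" "b \<in> I"
      "m \<in> wspan (below w)" "m' \<in> wspan (below w)" "xw w \<otimes> r = a \<oplus> m" "xw w \<otimes> s = b \<oplus> m'"
      unfolding lead_ideal_def by blast
    have c: "a \<in> carrier A" "b \<in> carrier A" "m \<in> carrier A" "m' \<in> carrier A"
      using rs Icl(1) below_span_carrier by auto
    have "xw w \<otimes> (r \<oplus> s) = (a \<oplus> b) \<oplus> (m \<oplus> m')"
      using rs w c by (simp add: r_distr a_ac)
    moreover have "r \<oplus> s \<in> K" using K_closed rs by simp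
    ultimately have "r \<oplus> s \<in> lead_ideal w I"
      using Icl(3)[OF rs(3,4)] below_span_closed(1)[OF rs(5,6)] unfolding lead_ideal_def by blast
    then show "r \<oplus>\<^bsub>KR\<^esub> s \<in> lead_ideal w I" by simp
  next
    fix r s assume "r \<in> lead_ideal w I" "s \<in> carrier KR"
    then obtain a m where r: "r \<in> K" "s \<in> K" "a \<in> I"
      "m \<in> wspan (below w)" "xw w \<otimes> r = a \<oplus> m"
      unfolding lead_ideal_def by auto
    obtain t f where t: "t \<in> K" "f \<in> wspan (shorter (length w))" "xw w \<otimes> s = t \<otimes> xw w \<oplus> f"
      using xw_mult_K[OF w r(2)] by blast
    have f: "f \<in> wspan (below w)" by (rule shorter_span_below[OF t(2)])
    have c: "a \<in> carrier A" "m \<in> carrier A" "f \<in> carrier A" "xw w \<in> carrier A"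
      using r Icl(1) below_span_carrier f w by auto
    have "xw w \<otimes> (s \<otimes> r) = (xw w \<otimes> s) \<otimes> r" using c r by (simp add: m_assoc)
    also have "\<dots> = t \<otimes> (xw w \<otimes> r) \<oplus> f \<otimes> r" unfolding t(3) using c r t by (simp add: l_distr m_assoc)
    also have "\<dots> = t \<otimes> a \<oplus> (t \<otimes> m \<oplus> f \<otimes> r)" unfolding r(5) using c r t by (simp add: r_distr a_assoc)
    finally have "xw w \<otimes> (s \<otimes> r) = t \<otimes> a \<oplus> (t \<otimes> m \<oplus> f \<otimes> r)" .
    moreover have "t \<otimes> m \<oplus> f \<otimes> r \<in> wspan (below w)"
      using r t f by (intro below_span_closed below_span_mult_K)
    moreover have "t \<otimes> a \<in> I" using Icl(6) r t by simp
    moreover have "s \<otimes> r \<in> K" using K_closed r by simp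
    ultimately have "s \<otimes> r \<in> lead_ideal w I" unfolding lead_ideal_def by blast
    then show "s \<otimes>\<^bsub>KR\<^esub> r \<in> lead_ideal w I" by simp
  qed
qed

lemma lead_ideal_mono: "I \<subseteq> J \<Longrightarrow> lead_ideal w I \<subseteq> lead_ideal w J"
  unfolding lead_ideal_def by blast

lemma lead_ideal_Cons:
  assumes w: "w \<in> words" and i: "i \<in> {1..n}" and I: "left_ideal A I"
  shows "lead_ideal w I \<subseteq> lead_ideal (i # w) I"
proof
  note Icl = left_ideal_closed[OF I]
  fix r assume "r \<in> lead_ideal w I"
  then obtain a m where r: "r \<in> K" "a \<in> I" "m \<in> wspan (below w)" "xw w \<otimes> r = a \<oplus> m"
    unfolding lead_ideal_def by blast
  have c: "a \<in> carrier A" "m \<in> carrier A" "x i \<in> carrier A" "xw w \<in> carrier A"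
    using r Icl(1) below_span_carrier w x_carrier[OF i] by auto
  have "xw (i # w) \<otimes> r = x i \<otimes> (xw w \<otimes> r)" using c r by (simp add: m_assoc)
  also have "\<dots> = x i \<otimes> a \<oplus> x i \<otimes> m" unfolding r(4) using c by (simp add: r_distr)
  finally show "r \<in> lead_ideal (i # w) I"
    using r(1) Icl(6)[OF r(2) c(3)] below_span_x_mult[OF r(3) i w] unfolding lead_ideal_def by blast
qed

lemma lead_ideal_append:
  assumes "v \<in> words" "w \<in> words" "left_ideal A I"
  shows "lead_ideal w I \<subseteq> lead_ideal (v @ w) I"
  using assms(1)
proof (induction v)
  case (Cons i v)
  then have "v @ w \<in> words" "i \<in> {1..n}" "lead_ideal w I \<subseteq> lead_ideal (v @ w) I"
    using assms(2) by auto
  then show ?case using lead_ideal_Cons[of "v @ w" i I] assms(3) by simp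
qed simp

lemma lead_ideal_weq:
  assumes "mset v = mset w" "v \<in> words" and I: "left_ideal A I"
  shows "lead_ideal w I \<subseteq> lead_ideal v I"
proof
  note Icl = left_ideal_closed[OF I]
  fix r assume "r \<in> lead_ideal w I"
  then obtain a m where r: "r \<in> K" "a \<in> I" "m \<in> wspan (below w)" "xw w \<otimes> r = a \<oplus> m"
    unfolding lead_ideal_def by blast
  obtain d f where w: "w \<in> words" and d: "d \<in> Units KR" and f': "f \<in> wspan (shorter (length w))"
    and eq: "xw v = d \<otimes> xw w \<oplus> f"
    using weq_mset[OF assms(1,2)] unfolding weq_def by blast
  have dK: "d \<in> K" using Units_KR[OF d] by simp
  have f: "f \<in> wspan (below w)" by (rule shorter_span_below[OF f'])
  have c: "a \<in> carrier A" "m \<in> carrier A" "f \<in> carrier A" "xw w \<in> carrier A"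
    using r Icl(1) below_span_carrier f w by auto
  have "xw v \<otimes> r = d \<otimes> (xw w \<otimes> r) \<oplus> f \<otimes> r" unfolding eq using c r dK by (simp add: l_distr m_assoc)
  also have "\<dots> = d \<otimes> a \<oplus> (d \<otimes> m \<oplus> f \<otimes> r)" unfolding r(4) using c r dK by (simp add: r_distr a_assoc)
  finally have "xw v \<otimes> r = d \<otimes> a \<oplus> (d \<otimes> m \<oplus> f \<otimes> r)" .
  moreover have "below v = below w" by (simp add: below_def deg_exp_mset[OF assms(1)])
  then have "d \<otimes> m \<oplus> f \<otimes> r \<in> wspan (below v)"
    using r dK f by (simp only:) (intro below_span_closed below_span_mult_K)
  moreover have "d \<otimes> a \<in> I" using Icl(6) r dK by simp
  ultimately show "r \<in> lead_ideal v I" using r(1) unfolding lead_ideal_def by blast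
qed

lemma lead_ideal_subset:
  assumes "mset v \<subseteq># mset w" "v \<in> words" "w \<in> words" "left_ideal A I"
  shows "lead_ideal v I \<subseteq> lead_ideal w I"
proof -
  obtain u where u: "mset w = mset u + mset v"
    by (metis assms(1) ex_mset subset_mset.diff_add)
  then have "set u \<subseteq> set w" by (metis mset_append set_append set_mset_mset sup_ge1)
  then have "u \<in> words" using assms(3) by (auto simp: words_def in_lists_conv_set)
  then have "lead_ideal v I \<subseteq> lead_ideal (u @ v) I" using lead_ideal_append assms by blast
  also have "\<dots> \<subseteq> lead_ideal w I" by (rule lead_ideal_weq) (use u assms in auto)
  finally show ?thesis .
qed

definition below_eq :: "nat list \<Rightarrow> nat list set" where
  "below_eq w = {v \<in> words. deg_exp v = deg_exp w} \<union> below w"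

lemma below_eq_mono: "v \<in> below_eq w \<Longrightarrow> below_eq v \<subseteq> below_eq w"
  using below_trans[of _ v w] by (auto simp: below_eq_def below_def)

lemma below_eq_total: "v \<in> words \<Longrightarrow> w \<in> words \<Longrightarrow> v \<in> below_eq w \<or> w \<in> below_eq v"
  using total_lenlex[OF total_less_than] unfolding below_eq_def below_def total_on_def by blast

lemma wspan_below_eq:
  assumes "f \<in> wspan V" "V \<subseteq> words"
  shows "f = \<zero> \<or> (\<exists>w\<in>V. f \<in> wspan (below_eq w))"
  using assms(1)
proof (induction rule: wspan.induct)
  case (step r v f)
  have v: "v \<in> words" "v \<in> below_eq v" using step(2) assms(2) by (auto simp: below_eq_def)
  obtain w where w: "w \<in> V" "v \<in> below_eq w" "f \<in> wspan (below_eq w)"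
  proof (cases "f = \<zero>")
    case True
    then show ?thesis using that v step(2) by (simp add: wspan.zero)
  next
    case False
    then obtain w where w: "w \<in> V" "f \<in> wspan (below_eq w)" using step.IH by blast
    then have "w \<in> words" using assms(2) by blast
    show ?thesis
    proof (cases "v \<in> below_eq w")
      case True
      then show ?thesis using that w by blast
    next
      case False
      then have "w \<in> below_eq v" using below_eq_total v \<open>w \<in> words\<close> by blast
      then have "f \<in> wspan (below_eq v)" using span_mono[OF w(2) below_eq_mono] by blast
      then show ?thesis using that v step(2) by blast
    qed
  qed
  then show ?case using wspan.step[OF step(1)] by blast
qed simp

lemma wspan_below_eq_lead:
  assumes "f \<in> wspan (below_eq w)" "w \<in> words"
  shows "\<exists>a\<in>K. \<exists>m\<in>wspan (below w). f = a \<otimes> xw w \<oplus> m"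
  using assms(1)
proof (induction rule: wspan.induct)
  case zero
  show ?case using assms(2) K_closed
    by (intro bexI[of _ \<zero>]) (auto intro: wspan.zero)
next
  case (step r v f)
  obtain a m where am: "a \<in> K" "m \<in> wspan (below w)" "f = a \<otimes> xw w \<oplus> m" using step.IH by blast
  have mc: "m \<in> carrier A" using am below_span_carrier by blast
  show ?case
  proof (cases "v \<in> below w")
    case True
    have "v \<in> words" using True below_words by blast
    then have "r \<otimes> xw v \<oplus> f = a \<otimes> xw w \<oplus> (r \<otimes> xw v \<oplus> m)"
      unfolding am(3) using step(1) am mc assms(2) by (simp add: a_ac)
    moreover have "r \<otimes> xw v \<oplus> m \<in> wspan (below w)" by (rule wspan.step[OF step(1) True am(2)])
    ultimately show ?thesis using am(1) by blast
  next
    case False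
    then have v: "v \<in> words" "deg_exp v = deg_exp w" using step(2) by (auto simp: below_eq_def)
    have "weq v w" by (rule weq_mset[OF mset_deg_exp]) (use v assms in auto)
    then obtain d g where d: "d \<in> Units KR" and g': "g \<in> wspan (shorter (length w))"
      and eq: "xw v = d \<otimes> xw w \<oplus> g"
      unfolding weq_def by blast
    have dK: "d \<in> K" using Units_KR[OF d] by simp
    have g: "g \<in> wspan (below w)" by (rule shorter_span_below[OF g'])
    have gc: "g \<in> carrier A" using g below_span_carrier by blast
    have "r \<otimes> xw v \<oplus> f = (r \<otimes> d \<oplus> a) \<otimes> xw w \<oplus> (r \<otimes> g \<oplus> m)"
      unfolding am(3) eq using step(1) am mc gc dK assms(2) by (simp add: l_distr r_distr m_assoc a_ac)
    moreover have "r \<otimes> g \<oplus> m \<in> wspan (below w)"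
      using step(1) g am by (intro below_span_closed)
    moreover have "r \<otimes> d \<oplus> a \<in> K" using K_closed step(1) dK am by simp
    ultimately show ?thesis by blast
  qed
qed

lemma pbw_monomial_word:
  "\<exists>w\<in>words. pbw_monomial A n x \<alpha> = xw w"
proof -
  have "\<exists>w\<in>words. foldr (\<lambda>i m. (x i [^] \<alpha> i) \<otimes> m) is \<one> = xw w" if "set is \<subseteq> {1..n}" for "is"
    using that
  proof (induction "is")
    case Nil
    show ?case by (intro bexI[of _ "[]"]) auto
  next
    case (Cons i js)
    then obtain w where w: "w \<in> words" "foldr (\<lambda>i m. (x i [^] \<alpha> i) \<otimes> m) js \<one> = xw w" by auto
    have i: "i \<in> {1..n}" using Cons.prems by simp
    have "replicate k i \<in> words \<and> x i [^] k = xw (replicate k i)" for k :: nat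
    proof (induction k)
      case (Suc k)
      then show ?case using i nat_pow_Suc2[OF x_carrier[OF i], of k] by simp
    qed simp
    then have "replicate (\<alpha> i) i @ w \<in> words"
      "foldr (\<lambda>i m. (x i [^] \<alpha> i) \<otimes> m) (i # js) \<one> = xw (replicate (\<alpha> i) i @ w)"
      using w xw_append by auto
    then show ?case by blast
  qed
  moreover have "set [1..<Suc n] \<subseteq> {1..n}" by auto
  ultimately show ?thesis unfolding pbw_monomial_def .
qed

lemma wspan_words: "wspan words = carrier A"
proof
  show "wspan words \<subseteq> carrier A" using span_carrier by blast
next
  show "carrier A \<subseteq> wspan words"
  proof
    fix a assume a: "a \<in> carrier A"
    have "pbw_free_basis A K n x"
      using pbw by (simp add: bijective_skew_PBW_extension_def skew_PBW_extension_def)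
    then have ex: "\<exists>f. f \<in> ({1..n} \<rightarrow>\<^sub>E UNIV) \<rightarrow>\<^sub>E K \<and>
        finite {\<alpha>\<in>{1..n} \<rightarrow>\<^sub>E UNIV. f \<alpha> \<noteq> \<zero>} \<and>
        a = (\<Oplus>\<alpha>\<in>{\<alpha>\<in>{1..n} \<rightarrow>\<^sub>E UNIV. f \<alpha> \<noteq> \<zero>}. f \<alpha> \<otimes> pbw_monomial A n x \<alpha>)"
      unfolding pbw_free_basis_def using a by blast
    then obtain f where f: "f \<in> ({1..n} \<rightarrow>\<^sub>E UNIV) \<rightarrow>\<^sub>E K"
      and fin: "finite {\<alpha>\<in>{1..n} \<rightarrow>\<^sub>E UNIV. f \<alpha> \<noteq> \<zero>}"
      and eq: "a = (\<Oplus>\<alpha>\<in>{\<alpha>\<in>{1..n} \<rightarrow>\<^sub>E UNIV. f \<alpha> \<noteq> \<zero>}. f \<alpha> \<otimes> pbw_monomial A n x \<alpha>)"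
      by (elim exE conjE)
    have summand: "f \<alpha> \<otimes> pbw_monomial A n x \<alpha> \<in> wspan words" if "\<alpha> \<in> {1..n} \<rightarrow>\<^sub>E UNIV" for \<alpha>
    proof -
      obtain w where w: "w \<in> words" "pbw_monomial A n x \<alpha> = xw w" using pbw_monomial_word by blast
      have "f \<alpha> \<in> K" using f that by (rule PiE_mem)
      then show ?thesis unfolding w(2) using w(1) by (intro span_word) auto
    qed
    have "(\<Oplus>\<alpha>\<in>B. f \<alpha> \<otimes> pbw_monomial A n x \<alpha>) \<in> wspan words"
      if "finite B" "B \<subseteq> {1..n} \<rightarrow>\<^sub>E UNIV" for B
      using that
    proof (induction B)
      case empty
      show ?case by (simp add: wspan.zero)
    next
      case (insert \<beta> B)
      have "f \<alpha> \<otimes> pbw_monomial A n x \<alpha> \<in> carrier A" if "\<alpha> \<in> insert \<beta> B" for \<alpha>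
        using span_carrier[OF summand] insert.prems that by blast
      then have "(\<Oplus>\<alpha>\<in>insert \<beta> B. f \<alpha> \<otimes> pbw_monomial A n x \<alpha>) =
          f \<beta> \<otimes> pbw_monomial A n x \<beta> \<oplus> (\<Oplus>\<alpha>\<in>B. f \<alpha> \<otimes> pbw_monomial A n x \<alpha>)"
        by (intro finsum_insert) (use insert in auto)
      moreover have "(\<Oplus>\<alpha>\<in>B. f \<alpha> \<otimes> pbw_monomial A n x \<alpha>) \<in> wspan words" using insert by blast
      moreover have "f \<beta> \<otimes> pbw_monomial A n x \<beta> \<in> wspan words"
        by (rule summand) (use insert.prems in blast)
      ultimately show ?case by (simp only:) (rule span_add, auto)
    qed
    then show "a \<in> wspan words" unfolding eq using fin by blast
  qed
qed

lemma lead_ideals_determine: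
  assumes I: "left_ideal A I" and J: "left_ideal A J" and IJ: "I \<subseteq> J"
    and lead: "\<And>w. w \<in> words \<Longrightarrow> lead_ideal w J \<subseteq> lead_ideal w I"
  shows "J \<subseteq> I"
proof
  note Icl = left_ideal_closed[OF I] and Jcl = left_ideal_closed[OF J]
  have claim: "b \<in> I" if "w \<in> words" "b \<in> J" "b \<in> wspan (below_eq w)" for w b
    using that
  proof (induction "deg_exp w" arbitrary: w b rule: wf_induct_rule[OF wf_lenlex[OF wf_less_than]])
    case 1
    note w = 1(2) and bJ = 1(3)
    obtain a m where am: "a \<in> K" "m \<in> wspan (below w)" "b = a \<otimes> xw w \<oplus> m"
      using wspan_below_eq_lead[OF 1(4) w] by blast
    obtain r f where r: "r \<in> K" "f \<in> wspan (shorter (length w))" "a \<otimes> xw w = xw w \<otimes> r \<oplus> f"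
      using K_mult_xw[OF w am(1)] by blast
    define g where "g = f \<oplus> m"
    have g: "g \<in> wspan (below w)"
      unfolding g_def using am shorter_span_below[OF r(2)] by (intro below_span_closed)
    have c: "b \<in> carrier A" "g \<in> carrier A" "xw w \<otimes> r \<in> carrier A" "f \<in> carrier A" "m \<in> carrier A"
      using Jcl(1) bJ below_span_carrier g w r(1) am shorter_span_below[OF r(2)] by auto
    have b: "b = xw w \<otimes> r \<oplus> g" unfolding am(3) r(3) g_def using c by (simp add: a_assoc)
    have "xw w \<otimes> r = b \<oplus> \<ominus> g" unfolding b using c by (simp add: a_assoc r_neg)
    moreover have "\<ominus> g \<in> wspan (below w)" by (rule span_neg[OF g below_words])
    ultimately have "r \<in> lead_ideal w J" unfolding lead_ideal_def using r(1) bJ by blast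
    then have "r \<in> lead_ideal w I" using lead[OF w] by blast
    then obtain i m' where i: "i \<in> I" "m' \<in> wspan (below w)" "xw w \<otimes> r = i \<oplus> m'"
      unfolding lead_ideal_def by blast
    have ic: "i \<in> carrier A" "m' \<in> carrier A" using i Icl(1) below_span_carrier by auto
    define b' where "b' = m' \<oplus> g"
    have b'_span: "b' \<in> wspan (below w)" unfolding b'_def using i g by (intro below_span_closed)
    then have b'c: "b' \<in> carrier A" by (rule below_span_carrier)
    have b': "b = b' \<oplus> i" unfolding b i(3) b'_def using ic c by (simp add: a_ac)
    have "b \<ominus> i = b'" unfolding b' using ic b'c by (simp add: a_minus_def a_assoc r_neg)
    then have b'J: "b' \<in> J" using Jcl(5)[OF bJ, of i] i(1) IJ by auto
    have "b' \<in> I"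
    proof (cases "b' = \<zero>")
      case True
      then show ?thesis using Icl(2) by simp
    next
      case False
      then obtain v where v: "v \<in> below w" "b' \<in> wspan (below_eq v)"
        using wspan_below_eq[OF b'_span below_words] by blast
      then have "(deg_exp v, deg_exp w) \<in> lenlex less_than" "v \<in> words" by (auto simp: below_def)
      then show ?thesis using 1(1)[of v b'] b'J v(2) by blast
    qed
    then show ?case unfolding b' by (rule Icl(3)[OF _ i(1)])
  qed
  fix b assume b: "b \<in> J"
  then have "b \<in> wspan words" using wspan_words Jcl(1) by blast
  then have "b = \<zero> \<or> (\<exists>w\<in>words. b \<in> wspan (below_eq w))" by (rule wspan_below_eq) simp
  then show "b \<in> I" using Icl(2) claim[OF _ b] by blast
qed

definition lead_family :: "'a set \<Rightarrow> nat list \<Rightarrow> 'a set" where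
  "lead_family I l = (if length l = n then lead_ideal (exponent_word l 1) I else undefined)"

lemma lead_family_mono_list:
  assumes I: "left_ideal A I"
  shows "lead_family I \<in> mono_list n {J. left_ideal KR J}"
  unfolding mono_list_def
proof (intro CollectI conjI allI impI)
  fix l :: "nat list" assume "length l = n"
  then show "left_ideal KR (lead_family I l)"
    using left_ideal_lead_ideal[OF exponent_word_words I] by (simp add: lead_family_def)
next
  fix l l' :: "nat list" assume l: "length l = n" "list_all2 (\<le>) l l'"
  then have "length l' = n" using list_all2_lengthD by force
  then show "lead_family I l \<le> lead_family I l'"
    using l lead_ideal_subset[OF mset_exponent_word_mono[OF l(2)] _ _ I] exponent_word_words
    by (simp add: lead_family_def)
qed (simp add: lead_family_def)

lemma lead_family_strict:
  assumes I: "left_ideal A I" and J: "left_ideal A J" and "I < J"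
  shows "lead_family I < lead_family J"
proof -
  have "lead_family I \<le> lead_family J"
    using lead_ideal_mono \<open>I < J\<close> by (auto simp: le_fun_def lead_family_def)
  moreover have "lead_family I \<noteq> lead_family J"
  proof
    assume eq: "lead_family I = lead_family J"
    have "lead_ideal w J \<subseteq> lead_ideal w I" if w: "w \<in> words" for w
    proof -
      obtain l where l: "length l = n" "mset (exponent_word l 1) = mset w"
        using words_exponent_word[OF w] by blast
      let ?e = "exponent_word l 1"
      have e: "?e \<in> words" by (rule exponent_word_words[OF l(1)])
      have "lead_ideal w J \<subseteq> lead_ideal ?e J" by (rule lead_ideal_weq[OF l(2) e J])
      also have "\<dots> = lead_ideal ?e I" using fun_cong[OF eq, of l] l(1) by (simp add: lead_family_def)
      also have "\<dots> \<subseteq> lead_ideal w I" using lead_ideal_weq[of w ?e I] l(2) w I by simp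
      finally show ?thesis .
    qed
    then have "J \<subseteq> I" using lead_ideals_determine[OF I J] \<open>I < J\<close> by blast
    then show False using \<open>I < J\<close> by blast
  qed
  ultimately show ?thesis by simp
qed

lemma left_ideals_bounds:
  assumes "acc {J. left_ideal KR J}" "dev_less k {J. left_ideal KR J}"
  shows "acc {I. left_ideal A I}" "dev_less (k + n) {I. left_ideal A I}"
proof -
  let ?M = "mono_list n {J. left_ideal KR J}"
  have M: "acc ?M" "dev_less (k + n) ?M" using mono_list_bounds[OF assms] by auto
  show "acc {I. left_ideal A I}"
    by (rule acc_strict_mono[OF M(1), where f = lead_family])
      (simp_all add: lead_family_mono_list lead_family_strict)
  show "dev_less (k + n) {I. left_ideal A I}"
    by (rule dev_less_strict_mono[OF M(2), where f = lead_family])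
      (simp_all add: lead_family_mono_list lead_family_strict)
qed

end

theorem theorem4p8:
  fixes A :: "('a, 'b) ring_scheme" and R :: "'a set"
    and n d k :: nat and x u :: "nat \<Rightarrow> 'a" and v :: 'a
  assumes "bijective_skew_PBW_extension A R n x"
    and "nc_domain (A\<lparr>carrier := R\<rparr>)"
    and "left_noetherian (A\<lparr>carrier := R\<rparr>)"
    and "rank_condition (A\<lparr>carrier := R\<rparr>)"
    and "rank_condition A"
    and "d \<ge> 1"
    and "has_lKdim (A\<lparr>carrier := R\<rparr>) k" and "k < d"
    and "\<forall>i\<in>{1..d + n}. u i \<in> carrier A" and "v \<in> carrier A"
  shows "\<exists>y. (\<forall>i\<in>{1..d + n}. y i \<in> carrier A) \<and>
     prime_closure A (u ` {1..d + n} \<union> {v}) =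
     prime_closure A ((\<lambda>i. u i \<oplus>\<^bsub>A\<^esub> (y i \<otimes>\<^bsub>A\<^esub> v)) ` {1..d + n})"
proof -
  have "ring A" using assms(1) by (simp add: bijective_skew_PBW_extension_def skew_PBW_extension_def)
  then interpret bijective_pbw A R n x
    using assms(1) by (intro bijective_pbw.intro bijective_pbw_axioms.intro)
  have acc: "acc {J. left_ideal KR J}"
    using assms(3) unfolding left_noetherian_def acc_def by simp
  have "dev_less (Suc k) {J. left_ideal KR J}"
    using assms(7) has_deviation_dev_less unfolding has_lKdim_def by blast
  then have "dev_less d {J. left_ideal KR J}"
    by (rule dev_less_mono[rotated]) (use assms(8) in simp)
  note bounds = left_ideals_bounds[OF acc this]
  show ?thesis
    by (rule noncommutative_Kronecker[OF bounds]) (use assms(9,10) in auto)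
qed

end
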